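(* Let $L\ge1$, let $n,d_0,\dots,d_L$ be positive integers, $X\in\mathbb{R}^{n\times d_0}$, $Y\in\mathbb{R}^{n\times d_L}$, and $W_\ell\in\mathbb{R}^{d_\ell\times d_{\ell-1}}$ for $\ell=1,\dots,L$. Assume: (i) $n\ge d_0$, $X$ has rank $d_0$, and $X$ has singular value decomposition $X=U_X\Sigma V_X^\top$ with $\Sigma=\Sigma_{11}I_{d_0}$, $\Sigma_{11}>0$, $U_X\in\mathbb{R}^{n\times d_0}$ with orthonormal columns, and $V_X\in\mathbb{R}^{d_0\times d_0}$ orthogonal; (ii) $W_\ell W_\ell^\top=W_{\ell+1}^\top W_{\ell+1}$ for all $\ell\in\{1,\dots,L-1\}$; (iii) the network implements the ordinary least-squares solution, $W_1^\top W_2^\top\cdots W_L^\top=X^\dagger Y$, where $X^\dagger$ is the Moore–Penrose inverse. Let $\sigma_i(W)$, $i\in\{1,\dots,\min\{d_0,\dots,d_L\}\}$, denote the shared singular values of the layers. Then $$\sigma_i(W)=\Sigma_{11}^{-1/L}\cdot\sigma_i^{1/L}(U_X^\top Y).$$ In particular, the spectral norm of the NTK matrix $\frac1n JJ^\top$ of the network $x\mapsto xW_1^\top\cdots W_L^\top$ on the inputs $X$ is given by $$\lambda_{\max}\left(\tfrac1n JJ^\top\right)=L\left(\frac{\|X\|_2^2}{n}\right)^{1/L}\left(\frac{\|U_X^\top Y\|_2^2}{n}\right)^{1-1/L}\le L\left(\frac{\|X\|_2^2}{n}\right)^{1/L}\left(\frac{\|Y\|_2^2}{n}\right)^{1-1/L},$$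 and this last bound is attained (equality holds) when $\mathcal{L}(W_1,\dots,W_L;X,Y)=0$.
   Context: $\|\cdot\|_2$ is the spectral norm, $\|\cdot\|_F$ the Frobenius norm, $\sigma_i(\cdot)$ the $i$-th largest singular value, $\otimes$ the Kronecker product; empty matrix products are identity matrices, and $0^0=1$. The loss is $\mathcal{L}(W_1,\dots,W_L;X,Y)=\frac1{2n}\|XW_1^\top W_2^\top\cdots W_L^\top-Y\|_F^2$. Put $S_\ell=W_{\ell+1}^\top\cdots W_L^\top\in\mathbb{R}^{d_\ell\times d_L}$ and $P_\ell=W_1^\top\cdots W_{\ell-1}^\top\in\mathbb{R}^{d_0\times d_{\ell-1}}$. $J=[J_1\ \cdots\ J_L]$ with $J_\ell=S_\ell^\top\otimes(XP_\ell)$ is the Jacobian of the predictions $XW_1^\top\cdots W_L^\top$ with respect to all weights, and the Neural Tangent Kernel (NTK) matrix is $$\tfrac1n JJ^\top=\sum_{\ell=1}^L (S_\ell^\top S_\ell)\otimes\left(\tfrac1n XP_\ell P_\ell^\top X^\top\right)\in\mathbb{R}^{d_Ln\times d_Ln}.$$ Under condition (ii) all layers have the same non-zero singular values (with multiplicity), hence the same $i$-th largest singular value for each $i\le\min\{d_0,\dots,d_L\}$; this common value is denoted $\sigma_i(W)$. *)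

theory Defs
  imports
    "Jordan_Normal_Form.Spectral_Radius"
    "Jordan_Normal_Form.DL_Rank"
begin

section \<open>Matrix norms, singular values, eigenvalues\<close>

definition vec_norm2 :: "real vec \<Rightarrow> real" where
  "vec_norm2 v = sqrt (v \<bullet> v)"

definition spectral_norm :: "real mat \<Rightarrow> real" where
  "spectral_norm A = (SUP v \<in> {v \<in> carrier_vec (dim_col A). vec_norm2 v = 1}. vec_norm2 (A *\<^sub>v v))"

definition frobenius_norm :: "real mat \<Rightarrow> real" where
  "frobenius_norm A = sqrt (\<Sum>i<dim_row A. \<Sum>j<dim_col A. (A $$ (i, j))\<^sup>2)"

text \<open>
  The singular values in decreasing order, with multiplicity: the square roots of the
  \<open>min (dim_row A) (dim_col A)\<close> largest eigenvalues of \<open>A\<^sup>T A\<close>.  The roots of the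
  characteristic polynomial are collected with their algebraic multiplicities; as
  \<open>A\<^sup>T A\<close> is symmetric, all of its eigenvalues are real.
\<close>

definition singular_values :: "real mat \<Rightarrow> real list" where
  "singular_values A =
     map sqrt (take (min (dim_row A) (dim_col A))
       (rev (sorted_list_of_multiset (proots (char_poly (transpose_mat A * A))))))"

text \<open>The index \<open>i\<close> starts at 1 and is meant to satisfy \<open>i \<le> min (dim_row A) (dim_col A)\<close>.\<close>

definition singular_value :: "real mat \<Rightarrow> nat \<Rightarrow> real" where
  "singular_value A i = singular_values A ! (i - 1)"

definition lambda_max :: "real mat \<Rightarrow> real" where
  "lambda_max A = Max (spectrum A)"


section \<open>Kronecker product, block rows, Moore--Penrose inverse\<close>

definition kronecker :: "real mat \<Rightarrow> real mat \<Rightarrow> real mat" (infixl \<open>\<otimes>\<^sub>K\<close> 70) where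
  "A \<otimes>\<^sub>K B =
     mat (dim_row A * dim_row B) (dim_col A * dim_col B)
       (\<lambda>(i, j). A $$ (i div dim_row B, j div dim_col B) * B $$ (i mod dim_row B, j mod dim_col B))"

text \<open>The block matrix \<open>[A\<^sub>1 \<dots> A\<^sub>k]\<close>, for blocks that all have \<open>r\<close> rows.\<close>

definition block_row :: "nat \<Rightarrow> real mat list \<Rightarrow> real mat" where
  "block_row r As = mat_of_cols r (concat (map cols As))"

definition is_moore_penrose :: "real mat \<Rightarrow> real mat \<Rightarrow> bool" where
  "is_moore_penrose A B \<longleftrightarrow>
     B \<in> carrier_mat (dim_col A) (dim_row A) \<and>
     A * B * A = A \<and> B * A * B = B \<and>
     transpose_mat (A * B) = A * B \<and> transpose_mat (B * A) = B * A"

definition moore_penrose :: "real mat \<Rightarrow> real mat" where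
  "moore_penrose A = (THE B. is_moore_penrose A B)"

text \<open>Real powers with \<open>0\<^sup>0 = 1\<close>; note that \<open>0 powr 0 = 0\<close> in the library.\<close>

definition rpow :: "real \<Rightarrow> real \<Rightarrow> real" where
  "rpow x a = (if a = 0 then 1 else x powr a)"


section \<open>Deep linear networks\<close>

text \<open>
  A network of depth \<open>L\<close> has layer widths \<open>d 0, \<dots>, d L\<close> and weights
  \<open>W l \<in> carrier_mat (d l) (d (l - 1))\<close> for \<open>l \<in> {1..L}\<close>.
  \<open>layer_prod d W a b\<close> is \<open>W\<^sub>a\<^sup>T W\<^sub>a\<^sub>+\<^sub>1\<^sup>T \<dots> W\<^sub>b\<^sup>T\<close>, of dimension \<open>d (a - 1) \<times> d b\<close>
  for \<open>1 \<le> a \<le> b + 1\<close>; in the empty case \<open>a = b + 1\<close> it is the identity of size \<open>d b\<close>.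
\<close>

definition layer_prod :: "(nat \<Rightarrow> nat) \<Rightarrow> (nat \<Rightarrow> real mat) \<Rightarrow> nat \<Rightarrow> nat \<Rightarrow> real mat" where
  "layer_prod d W a b =
     foldl (\<lambda>A l. A * transpose_mat (W l)) (1\<^sub>m (d (a - 1))) [a..<Suc b]"

definition loss :: "(nat \<Rightarrow> nat) \<Rightarrow> nat \<Rightarrow> (nat \<Rightarrow> real mat) \<Rightarrow> real mat \<Rightarrow> real mat \<Rightarrow> real" where
  "loss d L W X Y =
     1 / (2 * real (dim_row X)) * (frobenius_norm (X * layer_prod d W 1 L - Y))\<^sup>2"

definition suffix_prod :: "(nat \<Rightarrow> nat) \<Rightarrow> nat \<Rightarrow> (nat \<Rightarrow> real mat) \<Rightarrow> nat \<Rightarrow> real mat" where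
  "suffix_prod d L W l = layer_prod d W (l + 1) L"

definition prefix_prod :: "(nat \<Rightarrow> nat) \<Rightarrow> (nat \<Rightarrow> real mat) \<Rightarrow> nat \<Rightarrow> real mat" where
  "prefix_prod d W l = layer_prod d W 1 (l - 1)"

text \<open>
  With \<open>S\<^sub>l = suffix_prod d L W l\<close> and \<open>P\<^sub>l = prefix_prod d W l\<close>, the predictions are
  \<open>X P\<^sub>l W\<^sub>l\<^sup>T S\<^sub>l\<close>, and \<open>vec (X P\<^sub>l W\<^sub>l\<^sup>T S\<^sub>l) = (S\<^sub>l\<^sup>T \<otimes>\<^sub>K (X P\<^sub>l)) vec (W\<^sub>l\<^sup>T)\<close> for the
  column-stacking \<open>vec\<close>.  Hence the following is the Jacobian of the (column-stacked)
  predictions with respect to the entries of \<open>W\<^sub>l\<^sup>T\<close>.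
\<close>

definition jacobian_layer ::
    "(nat \<Rightarrow> nat) \<Rightarrow> nat \<Rightarrow> (nat \<Rightarrow> real mat) \<Rightarrow> real mat \<Rightarrow> nat \<Rightarrow> real mat" where
  "jacobian_layer d L W X l = transpose_mat (suffix_prod d L W l) \<otimes>\<^sub>K (X * prefix_prod d W l)"

definition jacobian ::
    "(nat \<Rightarrow> nat) \<Rightarrow> nat \<Rightarrow> (nat \<Rightarrow> real mat) \<Rightarrow> real mat \<Rightarrow> real mat" where
  "jacobian d L W X = block_row (d L * dim_row X) (map (jacobian_layer d L W X) [1..<Suc L])"

definition ntk :: "(nat \<Rightarrow> nat) \<Rightarrow> nat \<Rightarrow> (nat \<Rightarrow> real mat) \<Rightarrow> real mat \<Rightarrow> real mat" where
  "ntk d L W X =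
     (1 / real (dim_row X)) \<cdot>\<^sub>m (jacobian d L W X * transpose_mat (jacobian d L W X))"

end

theory Submission
  imports Defs "HOL-Analysis.L2_Norm"
begin

text \<open>
  Balancedness telescopes the Gram matrix of the end-to-end map: with
  \<open>M = W\<^sub>1\<^sup>T \<dots> W\<^sub>L\<^sup>T\<close> one gets \<open>M M\<^sup>T = (W\<^sub>1\<^sup>T W\<^sub>1)\<^sup>L\<close>, while
  the least-squares condition reads \<open>M = s\<^sup>-\<^sup>1 V U\<^sup>T Y\<close>. Comparing the nonzero eigenvalues of both
  expressions for \<open>M M\<^sup>T\<close> gives the singular values of the layers.

  For the kernel let \<open>\<sigma>\<close> be the common spectral norm of the layers. Each block satisfies
  \<open>\<parallel>J\<^sub>l\<parallel> \<le> s \<sigma>\<^sup>L\<^sup>-\<^sup>1\<close> by submultiplicativity. If \<open>p\<close> is a top eigenvector of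
  \<open>W\<^sub>1\<^sup>T W\<^sub>1\<close> and \<open>u\<close> one of \<open>W\<^sub>L W\<^sub>L\<^sup>T\<close>, then balancedness makes
  \<open>u \<otimes> U V\<^sup>T p\<close> an eigenvector of every \<open>J\<^sub>l J\<^sub>l\<^sup>T\<close> with eigenvalue
  \<open>(s \<sigma>\<^sup>L\<^sup>-\<^sup>1)\<^sup>2\<close>, so the bound \<open>L (s \<sigma>\<^sup>L\<^sup>-\<^sup>1)\<^sup>2\<close> for the sum over the layers is attained.
\<close>

section \<open>Orthogonal diagonalization of real symmetric matrices\<close>

text \<open>Two obstacles shape the development. The layers may have different widths, so their Gram
  matrices differ in size and their spectra agree only up to zeros; hence eigenvalues are compared
  as multisets without zeros. And \<open>singular_value\<close> is defined algebraically, through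
  roots of characteristic polynomials, whereas the bounds on the kernel are metric; orthogonal
  diagonalization of symmetric matrices links the two.

  The direction \<open>p\<close> is chosen by the weights alone. That it is also a direction of
  maximal stretch for \<open>X\<close> is due to the shape of the data: all singular values of
  \<open>X\<close> equal \<open>s\<close>, so every direction is stretched by the full factor
  \<open>s\<close>. The least-squares condition enters the kernel value through
  \<open>\<tau> = s * \<sigma> ^ L\<close>, where \<open>\<tau>\<close> is the spectral norm of
  \<open>U\<^sup>T Y\<close>; eliminating \<sigma> yields the exponents 1/L and 1 - 1/L. The
  remaining inequality holds because \<open>U\<^sup>T\<close> does not increase lengths, and zero
  loss turns it into an equality because \<open>Y\<close> then lies in the column space of
  \<open>U\<close>.\<close>

lemma real_symmetric_eigenvalue_exists:
  fixes A :: "real mat"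
  assumes A: "A \<in> carrier_mat n n" and sym: "transpose_mat A = A" and n: "n > 0"
  shows "\<exists>e. eigenvalue A e"
proof -
  let ?h = "complex_of_real"
  let ?C = "map_mat ?h A"
  have C: "?C \<in> carrier_mat n n" using A by auto
  from spectrum_non_empty[OF C n] obtain k where k: "eigenvalue ?C k"
    unfolding spectrum_def by auto
  then obtain v where v: "v \<in> carrier_vec n" "v \<noteq> 0\<^sub>v n" and ev: "?C *\<^sub>v v = k \<cdot>\<^sub>v v"
    using C unfolding eigenvalue_def eigenvector_def by auto
  let ?w = "conjugate v"
  have w: "?w \<in> carrier_vec n" using v by simp
  have symC: "transpose_mat ?C = ?C" using sym by (metis map_mat_transpose)
  have "?C *\<^sub>v ?w = conjugate (?C *\<^sub>v v)"
    by (rule eq_vecI) (use A v in \<open>auto simp: scalar_prod_def\<close>)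
  also have "\<dots> = cnj k \<cdot>\<^sub>v ?w"
    unfolding ev by (rule eq_vecI) auto
  finally have evw: "?C *\<^sub>v ?w = cnj k \<cdot>\<^sub>v ?w" .
  \<comment> \<open>Evaluated from either side, the symmetric bilinear form of \<open>?C\<close> at
    \<open>?w\<close> and \<open>v\<close> is the squared length of \<open>v\<close> times
    \<open>cnj k\<close> and times \<open>k\<close>. That length is not 0, so \<open>k\<close> is
    real.\<close>
  have "cnj k * (?w \<bullet> v) = (?C *\<^sub>v ?w) \<bullet> v"
    unfolding evw using v w by simp
  also have "\<dots> = ?w \<bullet> (?C *\<^sub>v v)"
    using transpose_vec_mult_scalar[OF C v(1) w] unfolding symC .
  also have "\<dots> = k * (?w \<bullet> v)"
    unfolding ev using v w by simp
  finally have eq: "cnj k * (?w \<bullet> v) = k * (?w \<bullet> v)" .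
  have "?w \<bullet> v = v \<bullet>c v" using comm_scalar_prod[OF w v(1)] .
  also have "\<dots> \<noteq> 0" using conjugate_square_eq_0_vec[OF v(1)] v(2) by simp
  finally have "cnj k = k" using eq by simp
  then have kr: "k = ?h (Re k)" by (simp add: complex_eq_iff)
  have "poly (map_poly ?h (char_poly A)) k = 0"
    using k unfolding eigenvalue_root_char_poly[OF C] of_real_hom.char_poly_hom[OF A] .
  then have "?h (poly (char_poly A) (Re k)) = 0"
    by (subst (asm) kr) simp
  then have "poly (char_poly A) (Re k) = 0" by simp
  then show ?thesis unfolding eigenvalue_root_char_poly[OF A, symmetric] by blast
qed

lemma conjugate_real_vec [simp]: "conjugate (v :: real vec) = v"
  by (rule eq_vecI) auto

lemma scalar_prod_self_pos:
  fixes v :: "real vec"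
  assumes "v \<in> carrier_vec n" "v \<noteq> 0\<^sub>v n"
  shows "v \<bullet> v > 0"
  using conjugate_square_greater_0_vec[OF assms(1)] assms(2) by simp

text \<open>Gram-Schmidt on a basis that starts with \<open>v\<close> keeps \<open>v\<close> in
  front, and normalizing the columns afterwards leaves it fixed because it has unit length.\<close>

lemma orthogonal_completion:
  fixes v :: "real vec"
  assumes v: "v \<in> carrier_vec n" and v1: "v \<bullet> v = 1"
  shows "\<exists>W \<in> carrier_mat n n. transpose_mat W * W = 1\<^sub>m n \<and> col W 0 = v"
proof -
  interpret cof_vec_space n "TYPE(real)" .
  have v0: "v \<noteq> 0\<^sub>v n" using v v1 by auto
  have n: "n > 0" using v v1 by (cases n) (auto simp: scalar_prod_def)
  define b where "b = basis_completion v"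
  define ws where "ws = gram_schmidt n b"
  from basis_completion[OF v v0, folded b_def]
  have dist_b: "distinct b" and indep: "\<not> lin_dep (set b)" and b: "set b \<subseteq> carrier_vec n"
    and hdb: "hd b = v" and len_b: "length b = n" by auto
  from hdb len_b n obtain vs where bv: "b = v # vs" by (cases b) auto
  from gram_schmidt_result[OF b dist_b indep refl, folded ws_def]
  have ws: "set ws \<subseteq> carrier_vec n" "corthogonal ws" "length ws = n"
    by (auto simp: len_b)
  from gram_schmidt_hd[OF v, of vs, folded bv] have "hd ws = v" unfolding ws_def .
  then have ws0: "ws ! 0 = v" using ws n by (cases ws) auto
  have wsc: "ws ! i \<in> carrier_vec n" if "i < n" for i using ws that by auto
  define c where "c i = 1 / sqrt (ws ! i \<bullet> ws ! i)" for i
  define W where "W = mat_of_cols n (map (\<lambda>i. c i \<cdot>\<^sub>v ws ! i) [0..<n])"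
  have W: "W \<in> carrier_mat n n" unfolding W_def by auto
  have colW: "col W i = c i \<cdot>\<^sub>v ws ! i" if "i < n" for i
    unfolding W_def using that wsc by (subst col_mat_of_cols) auto
  have "transpose_mat W * W = 1\<^sub>m n"
  proof (rule eq_matI)
    fix i j assume "i < dim_row (1\<^sub>m n :: real mat)" "j < dim_col (1\<^sub>m n :: real mat)"
    then have ij: "i < n" "j < n" by auto
    have "(transpose_mat W * W) $$ (i, j) = c i * (c j * (ws ! i \<bullet> ws ! j))"
      using W ij wsc[OF ij(1)] wsc[OF ij(2)] by (simp add: colW)
    also have "\<dots> = (if i = j then 1 else 0)"
    proof (cases "i = j")
      case True
      have "ws ! i \<bullet> ws ! i \<noteq> 0" using corthogonalD[OF ws(2), of i i] ij ws by simp
      moreover have "ws ! i \<bullet> ws ! i \<ge> 0" by (simp add: scalar_prod_def sum_nonneg)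
      ultimately show ?thesis using True by (simp add: c_def)
    next
      case False
      then show ?thesis using corthogonalD[OF ws(2), of i j] ij ws by simp
    qed
    finally show "(transpose_mat W * W) $$ (i, j) = 1\<^sub>m n $$ (i, j)" using ij by simp
  qed (use W in auto)
  moreover have "col W 0 = v" using colW[OF n] ws0 v1 by (simp add: c_def)
  ultimately show ?thesis using W by blast
qed

text \<open>Induction on the size by deflation. A unit eigenvector is completed to an orthogonal
  matrix \<open>W\<close>; conjugation by \<open>W\<close> sends it to the first basis vector, and
  symmetry then clears the first row together with the first column, which leaves a symmetric block
  of size \<open>n\<close>. The diagonal \<open>f\<close> comes in no particular order.\<close>

theorem real_symmetric_diagonalization:
  fixes A :: "real mat"
  assumes "A \<in> carrier_mat n n" "transpose_mat A = A"
  shows "\<exists>Q f. Q \<in> carrier_mat n n \<and> transpose_mat Q * Q = 1\<^sub>m n \<and> Q * transpose_mat Q = 1\<^sub>m n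
    \<and> A = Q * mat_diag n f * transpose_mat Q"
  using assms
proof (induction n arbitrary: A)
  case 0
  then show ?case
    by (intro exI[of _ "1\<^sub>m 0"] exI[of _ "\<lambda>_. 0"]) auto
next
  case (Suc n)
  note A = Suc.prems(1) and sym = Suc.prems(2)
  from real_symmetric_eigenvalue_exists[OF A sym] obtain e u where
    u: "u \<in> carrier_vec (Suc n)" "u \<noteq> 0\<^sub>v (Suc n)" and eu: "A *\<^sub>v u = e \<cdot>\<^sub>v u"
    using A unfolding eigenvalue_def eigenvector_def by auto
  have uu: "u \<bullet> u > 0" using scalar_prod_self_pos[OF u] .
  define v where "v = (1 / sqrt (u \<bullet> u)) \<cdot>\<^sub>v u"
  have v: "v \<in> carrier_vec (Suc n)" using u by (simp add: v_def)
  have vv: "v \<bullet> v = 1" using uu u by (simp add: v_def)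
  have ev: "A *\<^sub>v v = e \<cdot>\<^sub>v v"
    unfolding v_def mult_mat_vec[OF A u(1)] eu by (simp add: smult_smult_assoc mult.commute)
  from orthogonal_completion[OF v vv] obtain W where W: "W \<in> carrier_mat (Suc n) (Suc n)"
    and WW: "transpose_mat W * W = 1\<^sub>m (Suc n)" and W0: "col W 0 = v" by blast
  have Wt: "transpose_mat W \<in> carrier_mat (Suc n) (Suc n)" using W by simp
  have WWt: "W * transpose_mat W = 1\<^sub>m (Suc n)" by (rule mat_mult_left_right_inverse[OF Wt W WW])
  define B where "B = transpose_mat W * A * W"
  have B: "B \<in> carrier_mat (Suc n) (Suc n)" unfolding B_def using A W by auto
  have symB: "transpose_mat B = B"
    unfolding B_def using A W sym
    by (simp add: transpose_mult[of _ "Suc n" "Suc n" _ "Suc n"])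
  have AB: "A = W * B * transpose_mat W"
  proof -
    have "W * B * transpose_mat W = (W * transpose_mat W) * A * (W * transpose_mat W)"
      unfolding B_def using A W Wt
      by (simp add: assoc_mult_mat[of _ "Suc n" "Suc n" _ "Suc n" _ "Suc n"]
          mult_carrier_mat[of _ "Suc n" "Suc n" _ "Suc n"])
    then show ?thesis using A by (simp add: WWt)
  qed
  have "col B 0 = transpose_mat W *\<^sub>v (A *\<^sub>v col W 0)"
    unfolding B_def assoc_mult_mat[OF Wt A W] col_mult2[OF Wt mult_carrier_mat[OF A W] zero_less_Suc]
      col_mult2[OF A W zero_less_Suc] ..
  also have "\<dots> = e \<cdot>\<^sub>v (transpose_mat W *\<^sub>v col W 0)"
    unfolding W0 ev using mult_mat_vec[OF Wt v] .
  also have "transpose_mat W *\<^sub>v col W 0 = col (transpose_mat W * W) 0"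
    using W by auto
  also have "\<dots> = unit_vec (Suc n) 0" unfolding WW by simp
  finally have col0: "col B 0 = e \<cdot>\<^sub>v unit_vec (Suc n) 0" .
  have Bi0: "B $$ (i, 0) = (if i = 0 then e else 0)" if "i < Suc n" for i
  proof -
    have "B $$ (i, 0) = col B 0 $ i" using B that by simp
    also have "\<dots> = (if i = 0 then e else 0)" unfolding col0 using that by (simp add: unit_vec_def)
    finally show ?thesis .
  qed
  have B0i: "B $$ (0, i) = (if i = 0 then e else 0)" if "i < Suc n" for i
    using Bi0[OF that] arg_cong[OF symB, of "\<lambda>M. M $$ (i, 0)"] B that by simp
  define B1 where "B1 = mat n n (\<lambda>(i, j). B $$ (Suc i, Suc j))"
  have B1: "B1 \<in> carrier_mat n n" by (simp add: B1_def)
  have symB1: "transpose_mat B1 = B1"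
  proof (rule eq_matI)
    fix i j assume "i < dim_row B1" "j < dim_col B1"
    then show "transpose_mat B1 $$ (i, j) = B1 $$ (i, j)"
      using arg_cong[OF symB, of "\<lambda>M. M $$ (Suc i, Suc j)"] B by (simp add: B1_def)
  qed (simp_all add: B1_def)
  from Suc.IH[OF B1 symB1] obtain Q1 f where Q1: "Q1 \<in> carrier_mat n n"
    and Q1Q1: "transpose_mat Q1 * Q1 = 1\<^sub>m n" and Q1Q1t: "Q1 * transpose_mat Q1 = 1\<^sub>m n"
    and B1Q: "B1 = Q1 * mat_diag n f * transpose_mat Q1" by blast
  \<comment> \<open>Block-diagonal matrices with a scalar corner are closed under products and
    transposes. So the diagonalization of the block extends to full size, with corner 1 for the
    orthogonal factor and corner \<open>e\<close> for the diagonal one.\<close>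
  let ?F = "\<lambda>a M. four_block_mat (mat 1 1 (\<lambda>_. a)) (0\<^sub>m 1 n) (0\<^sub>m n 1) M"
  have tr1: "transpose_mat (mat 1 1 (\<lambda>_. a)) = mat 1 1 (\<lambda>_. a)" for a :: real
    by (rule eq_matI) auto
  have mul1: "mat 1 1 (\<lambda>_. a) * mat 1 1 (\<lambda>_. b) = mat 1 1 (\<lambda>_. a * b)" for a b :: real
    by (rule eq_matI) (auto simp: scalar_prod_def)
  have F_mult: "?F a M * ?F b N = ?F (a * b) (M * N)"
    if "M \<in> carrier_mat n n" "N \<in> carrier_mat n n" for a b and M N :: "real mat"
    using that
    by (subst mult_four_block_mat[of _ 1 1 _ n _ n _ _ 1 _ n]) (auto simp: mul1[simplified])
  have F_tr: "transpose_mat (?F a M) = ?F a (transpose_mat M)"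
    if "M \<in> carrier_mat n n" for a and M :: "real mat"
    using that by (subst transpose_four_block_mat[of _ 1 1 _ n _ n]) (auto simp: tr1[simplified])
  have Fc: "?F a M \<in> carrier_mat (Suc n) (Suc n)" if "M \<in> carrier_mat n n" for a and M :: "real mat"
    using that by auto
  have F1: "?F 1 (1\<^sub>m n) = 1\<^sub>m (Suc n)" by (rule eq_matI) auto
  have BF: "B = ?F e B1"
  proof (rule eq_matI)
    fix i j assume "i < dim_row (?F e B1)" "j < dim_col (?F e B1)"
    then have "i < Suc n" "j < Suc n" using B1 by auto
    then show "B $$ (i, j) = ?F e B1 $$ (i, j)"
      using B1 Bi0[of i] B0i[of j] by (cases i; cases j) (auto simp: B1_def)
  qed (use B B1 in auto)
  define g where "g i = (case i of 0 \<Rightarrow> e | Suc j \<Rightarrow> f j)" for i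
  have DF: "?F e (mat_diag n f) = mat_diag (Suc n) g"
    by (rule eq_matI) (auto simp: mat_diag_def g_def split: nat.splits)
  let ?Q1 = "?F 1 Q1"
  have Q1c: "?Q1 \<in> carrier_mat (Suc n) (Suc n)" by (rule Fc[OF Q1])
  have Q1t: "transpose_mat ?Q1 = ?F 1 (transpose_mat Q1)" by (rule F_tr[OF Q1])
  have BQ: "B = ?Q1 * mat_diag (Suc n) g * transpose_mat ?Q1"
    unfolding BF DF[symmetric] Q1t using Q1 by (subst F_mult | simp add: B1Q)+
  define Q where "Q = W * ?Q1"
  have Q: "Q \<in> carrier_mat (Suc n) (Suc n)" unfolding Q_def using W Q1c by auto
  have QT: "transpose_mat Q = transpose_mat ?Q1 * transpose_mat W"
    unfolding Q_def by (rule transpose_mult[OF W Q1c])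
  have Q1Tc: "transpose_mat ?Q1 \<in> carrier_mat (Suc n) (Suc n)" using Q1c by simp
  have Q1o: "transpose_mat ?Q1 * ?Q1 = 1\<^sub>m (Suc n)"
    unfolding Q1t by (subst F_mult) (use Q1 in \<open>auto simp: Q1Q1 F1[simplified]\<close>)
  have QQ: "transpose_mat Q * Q = 1\<^sub>m (Suc n)"
  proof -
    have "transpose_mat Q * Q = transpose_mat ?Q1 * ((transpose_mat W * W) * ?Q1)"
      unfolding QT unfolding Q_def
      by (simp only: assoc_mult_mat[OF Q1Tc Wt mult_carrier_mat[OF W Q1c]] assoc_mult_mat[OF Wt W Q1c])
    then show ?thesis unfolding WW using Q1c Q1o by (simp only: left_mult_one_mat)
  qed
  have QQt: "Q * transpose_mat Q = 1\<^sub>m (Suc n)"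
    by (rule mat_mult_left_right_inverse[OF _ Q QQ]) (use Q in simp)
  have D: "mat_diag (Suc n) g \<in> carrier_mat (Suc n) (Suc n)" by simp
  have "A = Q * mat_diag (Suc n) g * transpose_mat Q"
    unfolding AB BQ QT unfolding Q_def
    by (simp only: assoc_mult_mat[of _ "Suc n" "Suc n" _ "Suc n" _ "Suc n"]
          mult_carrier_mat[of _ "Suc n" "Suc n" _ "Suc n"] W Wt Q1c Q1Tc D)
  then show ?case using Q QQ QQt by blast
qed

section \<open>Nonzero eigenvalues and singular values\<close>

text \<open>Sylvester's determinant identity without division: the powers of the indeterminate give
  both sides degree \<open>m + n\<close> and account for the surplus zero eigenvalues of the larger
  product.\<close>

lemma char_poly_mult_swap:
  fixes A B :: "'a :: idom mat"
  assumes A: "A \<in> carrier_mat m n" and B: "B \<in> carrier_mat n m"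
  shows "[:0, 1:] ^ n * char_poly (A * B) = [:0, 1:] ^ m * char_poly (B * A)"
proof -
  let ?x = "[:0, 1:] :: 'a poly" and ?c = "map_mat (\<lambda>a. [:a:]) :: 'a mat \<Rightarrow> 'a poly mat"
  have cA: "?c A \<in> carrier_mat m n" and cB: "?c B \<in> carrier_mat n m" using A B by auto
  txt \<open>Both sides are computed from the determinant of the same block matrix \<open>?M\<close>, which is
    made block triangular in two ways.\<close>
  let ?M = "four_block_mat (?x \<cdot>\<^sub>m 1\<^sub>m m) (?c A) (?c B) (1\<^sub>m n)"
  let ?N1 = "four_block_mat (1\<^sub>m m) (0\<^sub>m m n) (- ?c B) (1\<^sub>m n)"
  let ?N2 = "four_block_mat (1\<^sub>m m) (- ?c A) (0\<^sub>m n m) (?x \<cdot>\<^sub>m 1\<^sub>m n)"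
  have M: "?M \<in> carrier_mat (m + n) (m + n)" by simp
  have N: "?N1 \<in> carrier_mat (m + n) (m + n)" "?N2 \<in> carrier_mat (m + n) (m + n)" by auto
  have char: "char_poly (C * D) = det (?x \<cdot>\<^sub>m 1\<^sub>m k - ?c C * ?c D)"
    if "C \<in> carrier_mat k j" "D \<in> carrier_mat j k" for C D :: "'a mat" and k j
  proof -
    have "?c C * ?c D = ?c (C * D)" using map_poly_mult(1)[OF that] by simp
    then show ?thesis
      unfolding char_poly_def char_poly_matrix_def
      by (intro arg_cong[of _ _ det] eq_matI) (use that in auto)
  qed
  have "?M * ?N1 = four_block_mat (?x \<cdot>\<^sub>m 1\<^sub>m m * 1\<^sub>m m + ?c A * (- ?c B))
      (?x \<cdot>\<^sub>m 1\<^sub>m m * 0\<^sub>m m n + ?c A * 1\<^sub>m n) (?c B * 1\<^sub>m m + 1\<^sub>m n * (- ?c B))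
      (?c B * 0\<^sub>m m n + 1\<^sub>m n * 1\<^sub>m n)"
    by (rule mult_four_block_mat[of _ m m _ n _ n _ _ m _ n]) (use cA cB in auto)
  also have "\<dots> = four_block_mat (?x \<cdot>\<^sub>m 1\<^sub>m m - ?c A * ?c B) (?c A) (0\<^sub>m n m) (1\<^sub>m n)"
  proof (rule cong_four_block_mat)
    have "1\<^sub>m n * (- ?c B) = - ?c B" using cB by simp
    then show "?c B * 1\<^sub>m m + 1\<^sub>m n * (- ?c B) = 0\<^sub>m n m" using cB by auto
    show "?x \<cdot>\<^sub>m 1\<^sub>m m * 1\<^sub>m m + ?c A * (- ?c B) = ?x \<cdot>\<^sub>m 1\<^sub>m m - ?c A * ?c B"
      using cA cB by (auto simp: minus_add_uminus_mat[of _ m m])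
  qed (use cA cB in \<open>auto simp: left_add_zero_mat[of _ m n] left_add_zero_mat[of _ n n]\<close>)
  finally have 1: "?M * ?N1 = \<dots>" .
  have "?M * ?N2 = four_block_mat (?x \<cdot>\<^sub>m 1\<^sub>m m * 1\<^sub>m m + ?c A * 0\<^sub>m n m)
      (?x \<cdot>\<^sub>m 1\<^sub>m m * - ?c A + ?c A * (?x \<cdot>\<^sub>m 1\<^sub>m n)) (?c B * 1\<^sub>m m + 1\<^sub>m n * 0\<^sub>m n m)
      (?c B * - ?c A + 1\<^sub>m n * (?x \<cdot>\<^sub>m 1\<^sub>m n))"
    by (rule mult_four_block_mat[of _ m m _ n _ n _ _ m _ n]) (use cA cB in auto)
  also have "\<dots> = four_block_mat (?x \<cdot>\<^sub>m 1\<^sub>m m) (0\<^sub>m m n) (?c B) (?x \<cdot>\<^sub>m 1\<^sub>m n - ?c B * ?c A)"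
  proof (rule cong_four_block_mat)
    show "?x \<cdot>\<^sub>m 1\<^sub>m m * - ?c A + ?c A * (?x \<cdot>\<^sub>m 1\<^sub>m n) = 0\<^sub>m m n"
      using cA by (intro eq_matI) (auto simp: mult_smult_assoc_mat[of _ m m _ n] mult_smult_distrib[of _ m n _ n])
    show "?c B * - ?c A + 1\<^sub>m n * (?x \<cdot>\<^sub>m 1\<^sub>m n) = ?x \<cdot>\<^sub>m 1\<^sub>m n - ?c B * ?c A"
      using cA cB by (intro eq_matI) auto
  qed (use cA cB in \<open>auto simp: right_add_zero_mat[of _ m m] right_add_zero_mat[of _ n m]\<close>)
  finally have 2: "?M * ?N2 = \<dots>" .
  \<comment> \<open>\<open>?N1\<close> clears the lower left block and has determinant 1.
    \<open>?N2\<close> clears the upper right block at the price of its own lower right block, which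
    is the origin of \<open>?x ^ n\<close>; the factor \<open>?x ^ m\<close> is the determinant of
    the upper left block that remains.\<close>
  have d1: "det ?N1 = 1" 
    using cB by (subst det_four_block_mat_upper_right_zero[of _ m _ n]) auto
  have dx: "det (?x \<cdot>\<^sub>m 1\<^sub>m k) = ?x ^ k" for k by (simp add: det_smult)
  have d2: "det ?N2 = ?x ^ n"
    using cA by (subst det_four_block_mat_lower_left_zero[of _ m _ n]) (auto simp: dx)
  have "det ?M * det ?N1 = det (?x \<cdot>\<^sub>m 1\<^sub>m m - ?c A * ?c B)"
    unfolding det_mult[OF M N(1), symmetric] 1
    using cA cB by (subst det_four_block_mat_lower_left_zero[of _ m _ n]) auto
  then have e1: "det ?M = char_poly (A * B)" unfolding d1 char[OF A B] by simp
  have "det ?M * det ?N2 = ?x ^ m * det (?x \<cdot>\<^sub>m 1\<^sub>m n - ?c B * ?c A)"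
    unfolding det_mult[OF M N(2), symmetric] 2
    using cA cB by (subst det_four_block_mat_upper_right_zero[of _ m _ n]) (auto simp: dx)
  then show ?thesis unfolding d2 e1 char[OF B A] by (simp add: mult.commute)
qed

text \<open>
  Without the zeros, the eigenvalues of \<open>A\<^sup>T A\<close> and \<open>A A\<^sup>T\<close> agree although the matrices
  have different sizes. Correspondingly \<open>nth_largest\<close> below is 0 beyond the size of the multiset;
  its index starts at 0, whereas that of \<open>singular_value\<close> starts at 1.
\<close>

definition nonzero_eigenvalues :: "real mat \<Rightarrow> real multiset" where
  "nonzero_eigenvalues A = filter_mset (\<lambda>x. x \<noteq> 0) (proots (char_poly A))"

lemma char_poly_nonzero:
  fixes A :: "'a :: comm_ring_1 mat"
  assumes "A \<in> carrier_mat n n" 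
  shows "char_poly A \<noteq> 0"
  using degree_monic_char_poly[OF assms] by auto

text \<open>By \<open>char_poly_mult_swap\<close> the two characteristic polynomials differ only by
  powers of the indeterminate. Those contribute roots 0, which the filter removes.\<close>

lemma nonzero_eigenvalues_mult_swap:
  assumes A: "A \<in> carrier_mat m n" and B: "B \<in> carrier_mat n m"
  shows "nonzero_eigenvalues (A * B) = nonzero_eigenvalues (B * A)"
proof -
  have *: "nonzero_eigenvalues C = filter_mset (\<lambda>x. x \<noteq> 0) (proots ([:0, 1:] ^ k * char_poly C))"
    if "C \<in> carrier_mat j j" for C :: "real mat" and j k
  proof -
    have "filter_mset (\<lambda>x. x \<noteq> 0) (repeat_mset k {#0 :: real#}) = {#}" by (induction k) auto
    then show ?thesis
      unfolding nonzero_eigenvalues_def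
      by (subst proots_mult) (auto simp: char_poly_nonzero[OF that] proots_power)
  qed
  show ?thesis
    using *[of "A * B" m n] *[of "B * A" n m] char_poly_mult_swap[OF A B] A B by simp
qed

text \<open>Similarity reduces to a diagonal matrix, whose characteristic polynomial splits into
  linear factors with roots \<open>f i\<close>. So \<open>f\<close> lists the eigenvalues with their
  algebraic multiplicities.\<close>

lemma proots_char_poly_diagonalized:
  fixes Q :: "real mat"
  assumes Q: "Q \<in> carrier_mat n n" and R: "R \<in> carrier_mat n n" and QR: "R * Q = 1\<^sub>m n" "Q * R = 1\<^sub>m n"
    and A: "A = Q * mat_diag n f * R"
  shows "proots (char_poly A) = image_mset f (mset_set {0..<n})"
proof -
  have "similar_mat A (mat_diag n f)"
    by (rule similar_matI[of _ _ Q R n]) (use assms in auto)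
  then have "char_poly A = char_poly (mat_diag n f)" by (rule char_poly_similar)
  also have "\<dots> = (\<Prod>a \<leftarrow> diag_mat (mat_diag n f). [:- a, 1:])"
    by (rule char_poly_upper_triangular[of _ n]) (auto simp: mat_diag_def)
  also have "diag_mat (mat_diag n f) = map f [0..<n]"
    by (auto simp: diag_mat_def mat_diag_def)
  finally have cp: "char_poly A = (\<Prod>a \<leftarrow> map f [0..<n]. [:- a, 1:])" .
  have "proots (\<Prod>a \<leftarrow> xs. [:- a, 1:]) = mset xs" for xs :: "real list"
  proof (induction xs)
    case (Cons a xs)
    have "(\<Prod>a \<leftarrow> xs. [:- a, 1:]) \<noteq> 0" by (auto simp: prod_list_zero_iff)
    then have "proots ([:- a, 1:] * (\<Prod>a \<leftarrow> xs. [:- a, 1:])) = {#a#} + mset xs"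
      by (subst proots_mult) (auto simp: Cons)
    then show ?case by simp
  qed simp
  then have "proots (char_poly A) = mset (map f [0..<n])" unfolding cp .
  then show ?thesis by simp
qed

lemma nonzero_eigenvalues_diagonalized:
  fixes Q :: "real mat"
  assumes "Q \<in> carrier_mat n n" "R \<in> carrier_mat n n" "R * Q = 1\<^sub>m n" "Q * R = 1\<^sub>m n"
    and "A = Q * mat_diag n f * R"
  shows "nonzero_eigenvalues A = filter_mset (\<lambda>x. x \<noteq> 0) (image_mset f (mset_set {0..<n}))"
  unfolding nonzero_eigenvalues_def proots_char_poly_diagonalized[OF assms] ..

lemma nonzero_eigenvalues_similar:
  assumes "similar_mat A B"
  shows "nonzero_eigenvalues A = nonzero_eigenvalues B"
  unfolding nonzero_eigenvalues_def char_poly_similar[OF assms] ..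

text \<open>In an orthogonal eigenbasis the power acts on the diagonal entries. Since
  \<open>k > 0\<close>, an entry vanishes exactly when its power does, so removing zeros commutes
  with taking powers.\<close>

lemma nonzero_eigenvalues_pow:
  fixes A :: "real mat"
  assumes A: "A \<in> carrier_mat n n" "transpose_mat A = A" and k: "k > 0"
  shows "nonzero_eigenvalues (A ^\<^sub>m k) = image_mset (\<lambda>x. x ^ k) (nonzero_eigenvalues A)"
proof -
  from real_symmetric_diagonalization[OF A] obtain Q f where Q: "Q \<in> carrier_mat n n"
    "transpose_mat Q * Q = 1\<^sub>m n" "Q * transpose_mat Q = 1\<^sub>m n"
    and AQ: "A = Q * mat_diag n f * transpose_mat Q" by blast
  have wit: "similar_mat_wit A (mat_diag n f) Q (transpose_mat Q)"
    by (rule similar_mat_witI[of _ _ n]) (use A Q AQ in auto)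
  have "mat_diag n f ^\<^sub>m k = mat_diag n (\<lambda>i. f i ^ k)"
  proof (induction k)
    case 0
    then show ?case by (simp add: mat_diag_def)
  next
    case (Suc k)
    then show ?case by (simp add: mult.commute)
  qed
  with similar_mat_wit_pow_id[OF wit, of k]
  have Ak: "A ^\<^sub>m k = Q * mat_diag n (\<lambda>i. f i ^ k) * transpose_mat Q" by simp
  have QT: "transpose_mat Q \<in> carrier_mat n n" using Q by simp
  show ?thesis
    unfolding nonzero_eigenvalues_diagonalized[OF Q(1) QT Q(2,3) AQ]
      nonzero_eigenvalues_diagonalized[OF Q(1) QT Q(2,3) Ak]
    using k by (simp add: filter_mset_image_mset o_def multiset.map_comp)
qed

lemma nonzero_eigenvalues_smult:
  fixes A :: "real mat"
  assumes A: "A \<in> carrier_mat n n" "transpose_mat A = A" and c: "c \<noteq> 0"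
  shows "nonzero_eigenvalues (c \<cdot>\<^sub>m A) = image_mset (\<lambda>x. c * x) (nonzero_eigenvalues A)"
proof -
  from real_symmetric_diagonalization[OF A] obtain Q f where Q: "Q \<in> carrier_mat n n"
    "transpose_mat Q * Q = 1\<^sub>m n" "Q * transpose_mat Q = 1\<^sub>m n"
    and AQ: "A = Q * mat_diag n f * transpose_mat Q" by blast
  have QT: "transpose_mat Q \<in> carrier_mat n n" using Q by simp
  have D: "mat_diag n (\<lambda>i. c * f i) = c \<cdot>\<^sub>m mat_diag n f"
    by (rule eq_matI) (auto simp: mat_diag_def)
  have Ac: "c \<cdot>\<^sub>m A = Q * mat_diag n (\<lambda>i. c * f i) * transpose_mat Q"
    unfolding AQ D using Q
    by (simp add: mult_smult_distrib[of _ n n _ n] mult_smult_assoc_mat[of _ n n _ n])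
  show ?thesis
    unfolding nonzero_eigenvalues_diagonalized[OF Q(1) QT Q(2,3) AQ]
      nonzero_eigenvalues_diagonalized[OF Q(1) QT Q(2,3) Ac]
    using c by (simp add: filter_mset_image_mset o_def multiset.map_comp)
qed

section \<open>Order statistics of multisets of nonnegative numbers\<close>

definition nth_largest :: "real multiset \<Rightarrow> nat \<Rightarrow> real" where
  "nth_largest M i = (if i < size M then rev (sorted_list_of_multiset M) ! i else 0)"

lemma length_sorted_list_of_multiset: "length (sorted_list_of_multiset M) = size M"
  using size_mset[of "sorted_list_of_multiset M"] by simp

lemma nth_largest_in:
  assumes "i < size M"
  shows "nth_largest M i \<in># M"
proof -
  have "rev (sorted_list_of_multiset M) ! i \<in> set (rev (sorted_list_of_multiset M))"
    by (rule nth_mem) (use assms in \<open>simp add: length_sorted_list_of_multiset\<close>)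
  then show ?thesis using assms by (simp add: nth_largest_def)
qed

lemma nth_largest_nonneg:
  assumes "\<And>x. x \<in># M \<Longrightarrow> x \<ge> 0"
  shows "nth_largest M i \<ge> 0"
  using assms nth_largest_in[of i M] by (cases "i < size M") (auto simp: nth_largest_def)

lemma sorted_list_of_multiset_eqI: "mset xs = M \<Longrightarrow> sorted xs \<Longrightarrow> sorted_list_of_multiset M = xs"
  using sorted_list_of_multiset_mset[of xs] by (simp add: sorted_sort_id)

text \<open>A monotone map keeps the sorted list sorted, and \<open>f 0 = 0\<close> takes care of
  the default value beyond the size.\<close>

lemma nth_largest_image_mset:
  assumes M: "\<And>x. x \<in># M \<Longrightarrow> x \<ge> 0" and f: "mono_on {0..} f" "f 0 = 0"
  shows "nth_largest (image_mset f M) i = f (nth_largest M i)"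
proof -
  have "sorted_list_of_multiset (image_mset f M) = map f (sorted_list_of_multiset M)"
  proof (rule sorted_list_of_multiset_eqI)
    show "sorted (map f (sorted_list_of_multiset M))"
      unfolding sorted_map
      by (rule sorted_wrt_mono_rel[OF _ sorted_sorted_list_of_multiset])
        (use M f in \<open>auto simp: mono_on_def\<close>)
  qed simp
  then show ?thesis by (simp add: nth_largest_def f rev_map length_sorted_list_of_multiset nth_map)
qed

lemma sorted_list_of_multiset_split_zeros:
  fixes M :: "real multiset"
  assumes "\<And>x. x \<in># M \<Longrightarrow> x \<ge> 0"
  shows "sorted_list_of_multiset M =
    replicate (count M 0) 0 @ sorted_list_of_multiset (filter_mset (\<lambda>x. x \<noteq> 0) M)"
proof (rule sorted_list_of_multiset_eqI)
  have "M = filter_mset (\<lambda>x. x = 0) M + filter_mset (\<lambda>x. x \<noteq> 0) M"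
    by (rule multiset_partition)
  then show "mset (replicate (count M 0) 0 @ sorted_list_of_multiset (filter_mset (\<lambda>x. x \<noteq> 0) M)) = M"
    by (simp add: filter_eq_replicate_mset)
  show "sorted (replicate (count M 0) 0 @ sorted_list_of_multiset (filter_mset (\<lambda>x. x \<noteq> 0) M))"
    using assms by (auto simp: sorted_append)
qed

text \<open>Nonnegativity puts the zeros at the front of the increasing list, so after reversal they
  are at the end. Removing them shortens the list only there, and the default value 0 of
  \<open>nth_largest\<close> takes their place.\<close>

lemma nth_sorted_eq_nth_largest:
  fixes M :: "real multiset"
  assumes "\<And>x. x \<in># M \<Longrightarrow> x \<ge> 0" and i: "i < size M"
  shows "rev (sorted_list_of_multiset M) ! i = nth_largest (filter_mset (\<lambda>x. x \<noteq> 0) M) i"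
proof -
  let ?N = "filter_mset (\<lambda>x. x \<noteq> 0) M"
  note l = length_sorted_list_of_multiset
  have "size M = count M 0 + size ?N"
    using l[of M] l[of ?N] sorted_list_of_multiset_split_zeros[OF assms(1)] by simp
  then show ?thesis
    using i unfolding nth_largest_def
    by (subst sorted_list_of_multiset_split_zeros[OF assms(1)]) (auto simp: nth_append l)
qed

text \<open>The entry \<open>f i\<close> is the squared length of column \<open>i\<close> of
  \<open>A * Q\<close>, hence nonnegative.\<close>

lemma gram_diagonalization:
  fixes A :: "real mat"
  assumes A: "A \<in> carrier_mat m n"
  shows "\<exists>Q f. Q \<in> carrier_mat n n \<and> transpose_mat Q * Q = 1\<^sub>m n \<and> Q * transpose_mat Q = 1\<^sub>m n
    \<and> transpose_mat A * A = Q * mat_diag n f * transpose_mat Q \<and> (\<forall>i<n. f i \<ge> 0)"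
proof -
  let ?G = "transpose_mat A * A"
  have G: "?G \<in> carrier_mat n n" using A by auto
  have "transpose_mat ?G = ?G" using A by (subst transpose_mult[of _ n m _ n]) auto
  from real_symmetric_diagonalization[OF G this] obtain Q f where Q: "Q \<in> carrier_mat n n"
    "transpose_mat Q * Q = 1\<^sub>m n" "Q * transpose_mat Q = 1\<^sub>m n"
    and GQ: "?G = Q * mat_diag n f * transpose_mat Q" by blast
  have QT: "transpose_mat Q \<in> carrier_mat n n" using Q by simp
  have D: "mat_diag n f \<in> carrier_mat n n" by simp
  have AQ: "A * Q \<in> carrier_mat m n" using A Q by auto
  have "f i \<ge> 0" if i: "i < n" for i
  proof -
    have "transpose_mat (A * Q) * (A * Q) = transpose_mat Q * ?G * Q"
      using A Q by (simp add: transpose_mult[OF A Q(1)] assoc_mult_mat[of _ n m _ n _ n]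
          assoc_mult_mat[of _ n n _ m _ n] assoc_mult_mat[of _ n n _ n _ n])
    also have "\<dots> = (transpose_mat Q * Q) * mat_diag n f * (transpose_mat Q * Q)"
      unfolding GQ
      by (simp only: assoc_mult_mat[of _ n n _ n _ n] mult_carrier_mat[of _ n n _ n] Q(1) QT D)
    also have "\<dots> = mat_diag n f" unfolding Q(2) by (simp add: left_mult_one_mat[OF D] right_mult_one_mat[OF D])
    finally have "(transpose_mat (A * Q) * (A * Q)) $$ (i, i) = f i"
      using i by (simp add: mat_diag_def)
    moreover have "(transpose_mat (A * Q) * (A * Q)) $$ (i, i) = col (A * Q) i \<bullet> col (A * Q) i"
      using AQ i A Q by simp
    ultimately have "f i = col (A * Q) i \<bullet> col (A * Q) i" by simp
    also have "\<dots> \<ge> 0" unfolding scalar_prod_def by (simp add: sum_nonneg)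
    finally show ?thesis .
  qed
  then show ?thesis using Q GQ by blast
qed

text \<open>Diagonalization shows that the characteristic polynomial of the Gram matrix splits over
  the reals. Hence the list that \<open>singular_values\<close> truncates is long enough for every
  index up to \<open>min m n\<close>.\<close>

lemma proots_gram:
  fixes A :: "real mat"
  assumes A: "A \<in> carrier_mat m n"
  shows "size (proots (char_poly (transpose_mat A * A))) = n"
    and "x \<in># proots (char_poly (transpose_mat A * A)) \<Longrightarrow> x \<ge> 0"
proof -
  from gram_diagonalization[OF A] obtain Q f where Q: "Q \<in> carrier_mat n n"
    "transpose_mat Q * Q = 1\<^sub>m n" "Q * transpose_mat Q = 1\<^sub>m n"
    and GQ: "transpose_mat A * A = Q * mat_diag n f * transpose_mat Q" and f: "\<forall>i<n. f i \<ge> 0" by blast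
  have QT: "transpose_mat Q \<in> carrier_mat n n" using Q by simp
  note * = proots_char_poly_diagonalized[OF Q(1) QT Q(2,3) GQ]
  show "size (proots (char_poly (transpose_mat A * A))) = n" unfolding * by simp
  show "x \<in># proots (char_poly (transpose_mat A * A)) \<Longrightarrow> x \<ge> 0" unfolding * using f by auto
qed

lemma nonzero_eigenvalues_gram_nonneg:
  assumes "A \<in> carrier_mat m n" "x \<in># nonzero_eigenvalues (transpose_mat A * A)"
  shows "x \<ge> 0"
  using proots_gram(2)[OF assms(1)] assms(2) unfolding nonzero_eigenvalues_def by simp

text \<open>Trades the truncated list, whose length depends on the shape of \<open>A\<close>, for a
  multiset that matrices of different shapes can share. The bounds on \<open>i\<close> keep it
  inside the truncation; the shift by 1 reconciles the two index conventions.\<close>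

lemma singular_value_eq_nth_largest:
  assumes A: "A \<in> carrier_mat m n" and i: "i \<ge> 1" "i \<le> m" "i \<le> n"
  shows "singular_value A i = sqrt (nth_largest (nonzero_eigenvalues (transpose_mat A * A)) (i - 1))"
proof -
  let ?M = "proots (char_poly (transpose_mat A * A))"
  have l: "length (sorted_list_of_multiset ?M) = n"
    using proots_gram(1)[OF A] by (simp add: length_sorted_list_of_multiset)
  have k: "i - 1 < length (take (min m n) (rev (sorted_list_of_multiset ?M)))" using l i by auto
  have "singular_value A i = sqrt (take (min m n) (rev (sorted_list_of_multiset ?M)) ! (i - 1))"
    unfolding singular_value_def singular_values_def carrier_matD[OF A] by (rule nth_map[OF k])
  also have "\<dots> = sqrt (rev (sorted_list_of_multiset ?M) ! (i - 1))"
    using i by (subst nth_take) auto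
  also have "\<dots> = sqrt (nth_largest (nonzero_eigenvalues (transpose_mat A * A)) (i - 1))"
    unfolding nonzero_eigenvalues_def
    by (subst nth_sorted_eq_nth_largest) (use proots_gram[OF A] i in auto)
  finally show ?thesis .
qed

lemma singular_value_transpose:
  assumes A: "A \<in> carrier_mat m n" and i: "i \<ge> 1" "i \<le> m" "i \<le> n"
  shows "singular_value (transpose_mat A) i = singular_value A i"
  using singular_value_eq_nth_largest[OF A i] singular_value_eq_nth_largest[of "transpose_mat A" n m i]
    nonzero_eigenvalues_mult_swap[of A m n "transpose_mat A"] A i by simp

section \<open>Spectral norm and Kronecker products\<close>

lemma scalar_prod_self_nonneg: "(v :: real vec) \<bullet> v \<ge> 0"
  unfolding scalar_prod_def by (simp add: sum_nonneg)

lemma vec_norm2_power2: "(vec_norm2 v)\<^sup>2 = v \<bullet> v"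
  by (simp add: vec_norm2_def scalar_prod_self_nonneg)

lemma vec_norm2_nonneg [simp]: "vec_norm2 v \<ge> 0"
  by (simp add: vec_norm2_def scalar_prod_self_nonneg)

lemma vec_norm2_eq_L2_set: "vec_norm2 v = L2_set (\<lambda>i. v $ i) {0..<dim_vec v}"
  by (simp add: vec_norm2_def L2_set_def scalar_prod_def power2_eq_square)

lemma vec_norm2_triangle:
  assumes "v \<in> carrier_vec n" "w \<in> carrier_vec n"
  shows "vec_norm2 (v + w) \<le> vec_norm2 v + vec_norm2 w"
proof -
  have "vec_norm2 (v + w) = L2_set (\<lambda>i. v $ i + w $ i) {0..<n}"
    using assms unfolding vec_norm2_eq_L2_set by (intro L2_set_cong) auto
  then show ?thesis
    using L2_set_triangle_ineq[of "\<lambda>i. v $ i" "\<lambda>i. w $ i" "{0..<n}"] assms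
    by (simp add: vec_norm2_eq_L2_set)
qed

lemma vec_norm2_smult: "vec_norm2 (c \<cdot>\<^sub>v v) = \<bar>c\<bar> * vec_norm2 v"
proof -
  have "(c \<cdot>\<^sub>v v) \<bullet> (c \<cdot>\<^sub>v v) = c\<^sup>2 * (v \<bullet> v)" by (simp add: power2_eq_square)
  then show ?thesis by (simp add: vec_norm2_def real_sqrt_mult)
qed

lemma vec_norm2_isometry:
  assumes U: "U \<in> carrier_mat m n" "transpose_mat U * U = 1\<^sub>m n" and v: "v \<in> carrier_vec n"
  shows "vec_norm2 (U *\<^sub>v v) = vec_norm2 v"
proof -
  have "v \<bullet> v = (transpose_mat U * U *\<^sub>v v) \<bullet> v" unfolding U(2) using v by simp
  also have "\<dots> = (transpose_mat U *\<^sub>v (U *\<^sub>v v)) \<bullet> v" using U(1) v by simp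
  also have "\<dots> = (U *\<^sub>v v) \<bullet> (U *\<^sub>v v)" by (rule transpose_vec_mult_scalar[of _ m n]) (use U v in auto)
  finally show ?thesis unfolding vec_norm2_def by simp
qed

text \<open>When all elements are 0, the filtered multiset is empty, and its default value 0 is
  still the maximum of the nonempty \<open>M\<close>.\<close>

lemma nth_largest_0_Max:
  fixes M :: "real multiset"
  assumes nonneg: "\<And>x. x \<in># M \<Longrightarrow> x \<ge> 0" and M: "M \<noteq> {#}"
  shows "nth_largest (filter_mset (\<lambda>x. x \<noteq> 0) M) 0 = Max (set_mset M)"
proof -
  have len: "size M > 0" using M by (simp add: nonempty_has_size)
  let ?xs = "sorted_list_of_multiset M"
  have ne: "?xs \<noteq> []" using len length_sorted_list_of_multiset[of M] by auto
  have "nth_largest (filter_mset (\<lambda>x. x \<noteq> 0) M) 0 = rev ?xs ! 0"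
    using nth_sorted_eq_nth_largest[OF nonneg len] by simp
  also have "\<dots> = last ?xs" using ne by (simp add: rev_nth last_conv_nth)
  also have "\<dots> = Max (set ?xs)"
  proof (rule Max_eqI[symmetric])
    fix y assume "y \<in> set ?xs"
    then obtain i where "i < length ?xs" "y = ?xs ! i" unfolding in_set_conv_nth by blast
    then show "y \<le> last ?xs"
      using sorted_nth_mono[OF sorted_sorted_list_of_multiset[of M], of i "length ?xs - 1"] ne
      by (simp add: last_conv_nth)
  qed (use ne in \<open>auto simp del: set_sorted_list_of_multiset\<close>)
  finally show ?thesis by simp
qed

text \<open>Rayleigh's principle. If \<open>y\<close> are the coordinates of \<open>v\<close> in an
  eigenbasis of \<open>A\<^sup>T A\<close>, the squared length of \<open>A v\<close> is the sum of
  \<open>f i * (y $ i)\<^sup>2\<close>, at most \<mu> times the squared length of \<open>y\<close>,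
  and \<open>y\<close> is as long as \<open>v\<close>. The eigenvector is the basis vector of a
  largest \<open>f k\<close>. Here the algebraic definition of singular values meets the metric
  bounds.\<close>

lemma top_singular_value:
  fixes A :: "real mat"
  assumes A: "A \<in> carrier_mat m n" and m: "m \<ge> 1" and n: "n \<ge> 1"
  shows "singular_value A 1 \<ge> 0"
    and "v \<in> carrier_vec n \<Longrightarrow> vec_norm2 (A *\<^sub>v v) \<le> singular_value A 1 * vec_norm2 v"
    and "\<exists>u \<in> carrier_vec n. u \<bullet> u = 1 \<and> transpose_mat A * A *\<^sub>v u = (singular_value A 1)\<^sup>2 \<cdot>\<^sub>v u"
proof -
  from gram_diagonalization[OF A] obtain Q f where Q: "Q \<in> carrier_mat n n"
    "transpose_mat Q * Q = 1\<^sub>m n" "Q * transpose_mat Q = 1\<^sub>m n"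
    and GQ: "transpose_mat A * A = Q * mat_diag n f * transpose_mat Q" and f: "\<forall>i<n. f i \<ge> 0" by blast
  have QT: "transpose_mat Q \<in> carrier_mat n n" using Q by simp
  have D: "mat_diag n f \<in> carrier_mat n n" by simp
  have pr: "proots (char_poly (transpose_mat A * A)) = image_mset f (mset_set {0..<n})"
    by (rule proots_char_poly_diagonalized[OF Q(1) QT Q(2,3) GQ])
  define \<mu> where "\<mu> = Max (f ` {0..<n})"
  have "nth_largest (nonzero_eigenvalues (transpose_mat A * A)) 0 = \<mu>"
    unfolding nonzero_eigenvalues_def \<mu>_def
    by (subst nth_largest_0_Max) (use f n in \<open>auto simp: pr mset_set_empty_iff\<close>)
  then have sv: "singular_value A 1 = sqrt \<mu>"
    using singular_value_eq_nth_largest[OF A, of 1] m n by simp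
  have "\<mu> \<in> f ` {0..<n}" unfolding \<mu>_def by (rule Max_in) (use n in auto)
  then obtain k where k: "k < n" "\<mu> = f k" by auto
  have f_le: "f i \<le> \<mu>" if "i < n" for i unfolding \<mu>_def using that by simp
  have \<mu>0: "\<mu> \<ge> 0" using k f by simp
  show "singular_value A 1 \<ge> 0" using sv \<mu>0 by simp
  have Gv: "transpose_mat A * A *\<^sub>v w = Q *\<^sub>v (mat_diag n f *\<^sub>v (transpose_mat Q *\<^sub>v w))"
    if "w \<in> carrier_vec n" for w
    unfolding GQ using that by (simp add: assoc_mult_mat_vec[OF mult_carrier_mat[OF Q(1) D] QT]
        assoc_mult_mat_vec[OF Q(1) D mult_mat_vec_carrier[OF QT]])
  have Dv: "mat_diag n f *\<^sub>v w = vec n (\<lambda>i. f i * w $ i)" if "w \<in> carrier_vec n" for w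
  proof (rule eq_vecI)
    fix i assume "i < dim_vec (vec n (\<lambda>i. f i * w $ i))"
    then have i: "i < n" by simp
    have "(mat_diag n f *\<^sub>v w) $ i = (\<Sum>j\<in>{0..<n}. (if i = j then f j else 0) * w $ j)"
      using i that by (simp add: scalar_prod_def mat_diag_def)
    also have "\<dots> = (\<Sum>j\<in>{0..<n}. if i = j then f j * w $ j else 0)" by (rule sum.cong) auto
    also have "\<dots> = f i * w $ i" using i by simp
    finally show "(mat_diag n f *\<^sub>v w) $ i = vec n (\<lambda>i. f i * w $ i) $ i" using i by simp
  qed (simp add: mat_diag_def)
  {
    assume v: "v \<in> carrier_vec n"
    let ?y = "transpose_mat Q *\<^sub>v v"
    have y: "?y \<in> carrier_vec n" by (rule mult_mat_vec_carrier[OF QT v])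
    note Dy = mult_mat_vec_carrier[OF D y]
    note QDy = mult_mat_vec_carrier[OF Q(1) Dy]
    have "(A *\<^sub>v v) \<bullet> (A *\<^sub>v v) = (transpose_mat A *\<^sub>v (A *\<^sub>v v)) \<bullet> v"
      by (rule transpose_vec_mult_scalar[of _ m n, symmetric]) (use A v in auto)
    also have "\<dots> = (transpose_mat A * A *\<^sub>v v) \<bullet> v" using A v by simp
    also have "\<dots> = v \<bullet> (Q *\<^sub>v (mat_diag n f *\<^sub>v ?y))"
      unfolding Gv[OF v] by (rule comm_scalar_prod[OF QDy v])
    also have "\<dots> = ?y \<bullet> (mat_diag n f *\<^sub>v ?y)"
      by (rule transpose_vec_mult_scalar[OF Q(1) Dy v, symmetric])
    also have "\<dots> = (\<Sum>i\<in>{0..<n}. f i * (?y $ i)\<^sup>2)"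
      unfolding Dv[OF y] scalar_prod_def by (auto simp: power2_eq_square intro!: sum.cong)
    also have "\<dots> \<le> (\<Sum>i\<in>{0..<n}. \<mu> * (?y $ i)\<^sup>2)"
      by (intro sum_mono mult_right_mono) (use f_le in auto)
    also have "\<dots> = \<mu> * (?y \<bullet> ?y)"
      unfolding scalar_prod_def carrier_vecD[OF y] by (simp add: power2_eq_square sum_distrib_left)
    also have "?y \<bullet> ?y = v \<bullet> v"
      using vec_norm2_isometry[OF QT _ v] Q(3) by (simp flip: vec_norm2_power2)
    finally have "(A *\<^sub>v v) \<bullet> (A *\<^sub>v v) \<le> \<mu> * (v \<bullet> v)" .
    then show "vec_norm2 (A *\<^sub>v v) \<le> singular_value A 1 * vec_norm2 v"
      unfolding sv vec_norm2_def real_sqrt_mult[symmetric] by simp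
  }
  let ?u = "Q *\<^sub>v unit_vec n k"
  have u: "?u \<in> carrier_vec n" using Q by simp
  have "transpose_mat Q *\<^sub>v ?u = unit_vec n k"
    using assoc_mult_mat_vec[OF QT Q(1) unit_vec_carrier[of n k]] by (simp add: Q(2))
  moreover have "mat_diag n f *\<^sub>v unit_vec n k = \<mu> \<cdot>\<^sub>v unit_vec n k"
    by (subst Dv) (auto simp: k)
  ultimately have "transpose_mat A * A *\<^sub>v ?u = \<mu> \<cdot>\<^sub>v ?u"
    unfolding Gv[OF u] by (simp add: mult_mat_vec[OF Q(1)])
  moreover have "vec_norm2 ?u = 1"
    using vec_norm2_isometry[OF Q(1,2), of "unit_vec n k"] k by (simp add: vec_norm2_def)
  then have "?u \<bullet> ?u = 1" by (simp flip: vec_norm2_power2)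
  ultimately show "\<exists>u \<in> carrier_vec n. u \<bullet> u = 1 \<and> transpose_mat A * A *\<^sub>v u = (singular_value A 1)\<^sup>2 \<cdot>\<^sub>v u"
    using u sv \<mu>0 by (intro bexI[of _ ?u]) auto
qed

lemma spectral_norm_eqI:
  assumes A: "A \<in> carrier_mat m n"
    and le: "\<And>v. v \<in> carrier_vec n \<Longrightarrow> vec_norm2 (A *\<^sub>v v) \<le> c * vec_norm2 v"
    and u: "u \<in> carrier_vec n" "vec_norm2 u = 1" "vec_norm2 (A *\<^sub>v u) = c"
  shows "spectral_norm A = c"
  unfolding spectral_norm_def
proof (rule cSup_eq_maximum)
  show "c \<in> (\<lambda>v. vec_norm2 (A *\<^sub>v v)) ` {v \<in> carrier_vec (dim_col A). vec_norm2 v = 1}"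
    using A u by (intro image_eqI[of _ _ u]) auto
next
  fix x assume "x \<in> (\<lambda>v. vec_norm2 (A *\<^sub>v v)) ` {v \<in> carrier_vec (dim_col A). vec_norm2 v = 1}"
  then show "x \<le> c" using le A by force
qed

lemma vec_norm2_top_singular_vector:
  assumes A: "A \<in> carrier_mat m n" and u: "u \<in> carrier_vec n" "u \<bullet> u = 1"
    and G: "transpose_mat A * A *\<^sub>v u = c\<^sup>2 \<cdot>\<^sub>v u" and c: "c \<ge> 0"
  shows "vec_norm2 (A *\<^sub>v u) = c"
proof -
  have "(A *\<^sub>v u) \<bullet> (A *\<^sub>v u) = (transpose_mat A *\<^sub>v (A *\<^sub>v u)) \<bullet> u"
    by (rule transpose_vec_mult_scalar[of _ m n, symmetric]) (use A u in auto)
  also have "\<dots> = (transpose_mat A * A *\<^sub>v u) \<bullet> u" using A u by simp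
  also have "\<dots> = c\<^sup>2" unfolding G using u by simp
  finally show ?thesis using c by (simp add: vec_norm2_def)
qed

lemma spectral_norm_eq_singular_value:
  assumes A: "A \<in> carrier_mat m n" and m: "m \<ge> 1" and n: "n \<ge> 1"
  shows "spectral_norm A = singular_value A 1"
proof -
  from top_singular_value(3)[OF A m n] obtain u where u: "u \<in> carrier_vec n" "u \<bullet> u = 1"
    "transpose_mat A * A *\<^sub>v u = (singular_value A 1)\<^sup>2 \<cdot>\<^sub>v u" by blast
  show ?thesis
  proof (rule spectral_norm_eqI[OF A _ u(1)])
    show "vec_norm2 u = 1" using u by (simp add: vec_norm2_def)
    show "vec_norm2 (A *\<^sub>v u) = singular_value A 1"
      by (rule vec_norm2_top_singular_vector[OF A u top_singular_value(1)[OF A m n]])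
  qed (rule top_singular_value(2)[OF A m n])
qed

lemma spectral_norm_bound:
  assumes "A \<in> carrier_mat m n" "m \<ge> 1" "n \<ge> 1" "v \<in> carrier_vec n"
  shows "vec_norm2 (A *\<^sub>v v) \<le> spectral_norm A * vec_norm2 v"
  using top_singular_value(2)[OF assms] spectral_norm_eq_singular_value[OF assms(1-3)] by simp

lemma spectral_norm_nonneg:
  assumes "A \<in> carrier_mat m n" "m \<ge> 1" "n \<ge> 1"
  shows "spectral_norm A \<ge> 0"
  using top_singular_value(1)[OF assms] spectral_norm_eq_singular_value[OF assms] by simp

lemma spectral_norm_le:
  assumes A: "A \<in> carrier_mat m n" and n: "n \<ge> 1"
    and le: "\<And>v. v \<in> carrier_vec n \<Longrightarrow> vec_norm2 (A *\<^sub>v v) \<le> c * vec_norm2 v"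
  shows "spectral_norm A \<le> c"
  unfolding spectral_norm_def
proof (rule cSUP_least)
  \<comment> \<open>The least-upper-bound argument requires a nonempty unit sphere; this is where
    \<open>n \<ge> 1\<close> enters.\<close>
  have "unit_vec n 0 \<in> {v \<in> carrier_vec (dim_col A). vec_norm2 v = 1}"
    using A n by (auto simp: vec_norm2_def)
  then show "{v \<in> carrier_vec (dim_col A). vec_norm2 v = 1} \<noteq> {}" by blast
next
  fix v assume "v \<in> {v \<in> carrier_vec (dim_col A). vec_norm2 v = 1}"
  then show "vec_norm2 (A *\<^sub>v v) \<le> c" using le[of v] A by auto
qed

text \<open>An eigenvector that attains the operator bound \<open>c\<close> settles both quantities:
  it makes the supremum a maximum, and the bound applied to any other eigenvector limits its
  eigenvalue by \<open>c\<close>. The kernel can thus be evaluated without diagonalizing it.\<close>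

lemma spectral_norm_lambda_max_eqI:
  assumes A: "A \<in> carrier_mat n n"
    and le: "\<And>v. v \<in> carrier_vec n \<Longrightarrow> vec_norm2 (A *\<^sub>v v) \<le> c * vec_norm2 v"
    and u: "u \<in> carrier_vec n" "vec_norm2 u = 1" "A *\<^sub>v u = c \<cdot>\<^sub>v u" and c: "c \<ge> 0"
  shows "spectral_norm A = c" and "lambda_max A = c"
proof -
  show "spectral_norm A = c"
    by (rule spectral_norm_eqI[OF A le u(1,2)]) (use u c in \<open>auto simp: vec_norm2_smult\<close>)
  show "lambda_max A = c"
    unfolding lambda_max_def
  proof (rule Max_eqI)
    show "finite (spectrum A)" by (rule card_finite_spectrum[OF A])
    have "u \<noteq> 0\<^sub>v n" using u(2) by (auto simp: vec_norm2_def)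
    then show "c \<in> spectrum A"
      using u A unfolding spectrum_def eigenvalue_def eigenvector_def by auto
  next
    fix k assume "k \<in> spectrum A"
    then obtain v where v: "v \<in> carrier_vec n" "v \<noteq> 0\<^sub>v n" "A *\<^sub>v v = k \<cdot>\<^sub>v v"
      using A unfolding spectrum_def eigenvalue_def eigenvector_def by auto
    have "vec_norm2 v > 0" using scalar_prod_self_pos[OF v(1,2)] by (simp add: vec_norm2_def)
    moreover have "\<bar>k\<bar> * vec_norm2 v \<le> c * vec_norm2 v"
      using le[OF v(1)] unfolding v(3) vec_norm2_smult .
    ultimately show "k \<le> c" by simp
  qed
qed

section \<open>Kronecker products acting on vectors\<close>

lemma sum_block_index:
  fixes f :: "nat \<Rightarrow> 'a :: comm_monoid_add"
  shows "(\<Sum>i\<in>{0..<m * p}. f i) = (\<Sum>a\<in>{0..<m}. \<Sum>b\<in>{0..<p}. f (a * p + b))"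
proof -
  have "(\<Sum>i\<in>{0..<m * p}. f i) = (\<Sum>a<m. sum f {a * p..<a * p + p})"
    by (simp add: sum.nat_group atLeast0LessThan)
  also have "\<dots> = (\<Sum>a\<in>{0..<m}. \<Sum>b\<in>{0..<p}. f (a * p + b))"
  proof (rule sum.cong)
    fix a assume "a \<in> {0..<m}"
    show "sum f {a * p..<a * p + p} = (\<Sum>b\<in>{0..<p}. f (a * p + b))"
      using sum.shift_bounds_nat_ivl[of f 0 "a * p" p] by (simp add: add.commute)
  qed auto
  finally show ?thesis .
qed

lemma block_index_less: "a < m \<Longrightarrow> b < p \<Longrightarrow> a * p + b < m * (p :: nat)"
proof -
  assume "a < m" "b < p"
  then have "a * p + b < Suc a * p" by simp
  also have "\<dots> \<le> m * p" by (rule mult_le_mono1) (use \<open>a < m\<close> in simp)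
  finally show ?thesis .
qed

lemma block_index_div_mod:
  assumes "i < m * (p :: nat)"
  shows "i div p < m" "i mod p < p"
proof -
  show "i div p < m" using assms by (rule less_mult_imp_div_less)
  have "p > 0" using assms by (cases p) auto
  then show "i mod p < p" by simp
qed

lemma kronecker_carrier:
  "A \<in> carrier_mat m n \<Longrightarrow> B \<in> carrier_mat p q \<Longrightarrow> A \<otimes>\<^sub>K B \<in> carrier_mat (m * p) (n * q)"
  unfolding kronecker_def by auto

lemma transpose_kronecker: "transpose_mat (A \<otimes>\<^sub>K B) = transpose_mat A \<otimes>\<^sub>K transpose_mat B"
  by (rule eq_matI) (auto simp: kronecker_def block_index_div_mod)

text \<open>Reads \<open>v\<close> as \<open>n\<close> consecutive blocks of length
  \<open>q\<close>: \<open>B\<close> acts inside each block, and \<open>A\<close> mixes the blocks.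
  The row index \<open>i * p + k\<close> separates into block and position in the same way.\<close>

lemma kronecker_mult_vec_index:
  assumes A: "A \<in> carrier_mat m n" and B: "B \<in> carrier_mat p q" and v: "v \<in> carrier_vec (n * q)"
    and i: "i < m" and k: "k < p"
  shows "(A \<otimes>\<^sub>K B *\<^sub>v v) $ (i * p + k) =
    (\<Sum>j\<in>{0..<n}. A $$ (i, j) * (\<Sum>l\<in>{0..<q}. B $$ (k, l) * v $ (j * q + l)))"
proof -
  have "(A \<otimes>\<^sub>K B *\<^sub>v v) $ (i * p + k) = (\<Sum>j\<in>{0..<n * q}. (A \<otimes>\<^sub>K B) $$ (i * p + k, j) * v $ j)"
    using kronecker_carrier[OF A B] v block_index_less[OF i k] by (simp add: scalar_prod_def)
  also have "\<dots> = (\<Sum>j\<in>{0..<n}. \<Sum>l\<in>{0..<q}.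
      (A \<otimes>\<^sub>K B) $$ (i * p + k, j * q + l) * v $ (j * q + l))" by (rule sum_block_index)
  also have "\<dots> = (\<Sum>j\<in>{0..<n}. A $$ (i, j) * (\<Sum>l\<in>{0..<q}. B $$ (k, l) * v $ (j * q + l)))"
    unfolding sum_distrib_left
    using A B block_index_less[OF i k] block_index_less[of _ n _ q] k unfolding kronecker_def
    by (intro sum.cong refl) auto
  finally show ?thesis .
qed

text \<open>Amounts to factoring \<open>A \<otimes>\<^sub>K B\<close> into
  \<open>I \<otimes>\<^sub>K B\<close> followed by \<open>A \<otimes>\<^sub>K I\<close>. Each factor
  acts on disjoint slices of the vector, so its bound on one slice carries over to the sum of
  squares.\<close>

lemma vec_norm2_kronecker_le:
  assumes A: "A \<in> carrier_mat m n" and B: "B \<in> carrier_mat p q" and v: "v \<in> carrier_vec (n * q)"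
    and a: "\<And>x. x \<in> carrier_vec n \<Longrightarrow> vec_norm2 (A *\<^sub>v x) \<le> a * vec_norm2 x"
    and b: "\<And>x. x \<in> carrier_vec q \<Longrightarrow> vec_norm2 (B *\<^sub>v x) \<le> b * vec_norm2 x"
    and ab: "a \<ge> 0" "b \<ge> 0"
  shows "vec_norm2 (A \<otimes>\<^sub>K B *\<^sub>v v) \<le> a * b * vec_norm2 v"
proof -
  have sq: "(\<Sum>i\<in>{0..<k}. (x $ i)\<^sup>2) = (vec_norm2 x)\<^sup>2" if "x \<in> carrier_vec k" for x k
    unfolding vec_norm2_power2 using that by (simp add: scalar_prod_def power2_eq_square)
  \<comment> \<open>\<open>y j\<close> is block \<open>j\<close> of \<open>v\<close>, and
    \<open>w k\<close> collects the \<open>k\<close>-th coordinates of all the vectors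
    \<open>B *\<^sub>v y j\<close>. The squares are summed along the slices \<open>w k\<close> to
    use the bound on \<open>A\<close>; exchanging the sums regroups them into blocks, to which the
    bound on \<open>B\<close> applies.\<close>
  define y where "y j = vec q (\<lambda>l. v $ (j * q + l))" for j
  define w where "w k = vec n (\<lambda>j. (B *\<^sub>v y j) $ k)" for k
  have y: "y j \<in> carrier_vec q" and w: "w k \<in> carrier_vec n" for j k by (auto simp: y_def w_def)
  have r: "(A \<otimes>\<^sub>K B *\<^sub>v v) $ (i * p + k) = (A *\<^sub>v w k) $ i" if "i < m" "k < p" for i k
    unfolding kronecker_mult_vec_index[OF A B v that] using A B that
    by (auto simp: scalar_prod_def w_def y_def)
  have "A \<otimes>\<^sub>K B *\<^sub>v v \<in> carrier_vec (m * p)" using kronecker_carrier[OF A B] v by auto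
  from sq[OF this] have "(vec_norm2 (A \<otimes>\<^sub>K B *\<^sub>v v))\<^sup>2 = (\<Sum>i\<in>{0..<m}. \<Sum>k\<in>{0..<p}. ((A *\<^sub>v w k) $ i)\<^sup>2)"
    by (simp add: sum_block_index r)
  also have "\<dots> = (\<Sum>k\<in>{0..<p}. (vec_norm2 (A *\<^sub>v w k))\<^sup>2)"
    by (subst sum.swap) (rule sum.cong[OF refl sq[OF mult_mat_vec_carrier[OF A w]]])
  also have "\<dots> \<le> (\<Sum>k\<in>{0..<p}. (a * vec_norm2 (w k))\<^sup>2)"
    by (intro sum_mono power_mono a w) simp
  also have "\<dots> = a\<^sup>2 * (\<Sum>k\<in>{0..<p}. \<Sum>j\<in>{0..<n}. ((B *\<^sub>v y j) $ k)\<^sup>2)"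
    unfolding sum_distrib_left power_mult_distrib sq[OF w, symmetric] by (simp add: w_def)
  also have "(\<Sum>k\<in>{0..<p}. \<Sum>j\<in>{0..<n}. ((B *\<^sub>v y j) $ k)\<^sup>2) = (\<Sum>j\<in>{0..<n}. (vec_norm2 (B *\<^sub>v y j))\<^sup>2)"
    by (subst sum.swap) (rule sum.cong[OF refl sq[OF mult_mat_vec_carrier[OF B y]]])
  also have "\<dots> \<le> (\<Sum>j\<in>{0..<n}. (b * vec_norm2 (y j))\<^sup>2)"
    by (intro sum_mono power_mono b y) simp
  also have "\<dots> = b\<^sup>2 * (vec_norm2 v)\<^sup>2"
    unfolding power_mult_distrib sum_distrib_left[symmetric] sq[OF y, symmetric] sq[OF v, symmetric]
      sum_block_index by (simp add: y_def)
  finally have "(vec_norm2 (A \<otimes>\<^sub>K B *\<^sub>v v))\<^sup>2 \<le> (a * b * vec_norm2 v)\<^sup>2"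
    by (simp add: power_mult_distrib mult.assoc mult_left_mono)
  then show ?thesis by (rule power2_le_imp_le) (use ab in simp)
qed

text \<open>The Kronecker product of two columns, kept as a \<open>vec\<close> so that matrices can
  act on it. The index order is that of \<open>kronecker\<close>, with the first factor varying
  slowest.\<close>

definition kronecker_vec :: "real vec \<Rightarrow> real vec \<Rightarrow> real vec" where
  "kronecker_vec u w = vec (dim_vec u * dim_vec w) (\<lambda>j. u $ (j div dim_vec w) * w $ (j mod dim_vec w))"

lemma kronecker_vec_carrier:
  "u \<in> carrier_vec n \<Longrightarrow> w \<in> carrier_vec q \<Longrightarrow> kronecker_vec u w \<in> carrier_vec (n * q)"
  unfolding kronecker_vec_def by auto

lemma kronecker_vec_index:
  assumes "u \<in> carrier_vec n" "w \<in> carrier_vec q" "j < n" "l < q"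
  shows "kronecker_vec u w $ (j * q + l) = u $ j * w $ l"
  using assms block_index_less[OF assms(3,4)] unfolding kronecker_vec_def by auto

text \<open>On a product vector the double sum over block and position factors. This reduces
  eigenvector claims about Kronecker products to claims about their factors.\<close>

lemma kronecker_mult_kronecker_vec:
  assumes A: "A \<in> carrier_mat m n" and B: "B \<in> carrier_mat p q"
    and u: "u \<in> carrier_vec n" and w: "w \<in> carrier_vec q"
  shows "A \<otimes>\<^sub>K B *\<^sub>v kronecker_vec u w = kronecker_vec (A *\<^sub>v u) (B *\<^sub>v w)"
proof (rule eq_vecI)
  have Au: "A *\<^sub>v u \<in> carrier_vec m" and Bw: "B *\<^sub>v w \<in> carrier_vec p"
    using mult_mat_vec_carrier[OF A u] mult_mat_vec_carrier[OF B w] by auto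
  show "dim_vec (A \<otimes>\<^sub>K B *\<^sub>v kronecker_vec u w) = dim_vec (kronecker_vec (A *\<^sub>v u) (B *\<^sub>v w))"
    unfolding kronecker_def kronecker_vec_def by simp
  fix i assume "i < dim_vec (kronecker_vec (A *\<^sub>v u) (B *\<^sub>v w))"
  then have "i < m * p" using kronecker_vec_carrier[OF Au Bw] by simp
  then have i: "i div p < m" "i mod p < p"
    by (rule block_index_div_mod)+
  have "(A \<otimes>\<^sub>K B *\<^sub>v kronecker_vec u w) $ (i div p * p + i mod p) =
     (\<Sum>j\<in>{0..<n}. A $$ (i div p, j) * (\<Sum>l\<in>{0..<q}. B $$ (i mod p, l) * (u $ j * w $ l)))"
    by (subst kronecker_mult_vec_index[OF A B kronecker_vec_carrier[OF u w] i])
      (simp add: kronecker_vec_index[OF u w])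
  also have "\<dots> = (\<Sum>j\<in>{0..<n}. A $$ (i div p, j) * u $ j * (\<Sum>l\<in>{0..<q}. B $$ (i mod p, l) * w $ l))"
    by (simp add: sum_distrib_left mult_ac)
  also have "\<dots> = (A *\<^sub>v u) $ (i div p) * (B *\<^sub>v w) $ (i mod p)"
    using A B u w i by (simp add: scalar_prod_def sum_distrib_right)
  also have "\<dots> = kronecker_vec (A *\<^sub>v u) (B *\<^sub>v w) $ (i div p * p + i mod p)"
    by (rule kronecker_vec_index[OF Au Bw i, symmetric])
  finally show "(A \<otimes>\<^sub>K B *\<^sub>v kronecker_vec u w) $ i = kronecker_vec (A *\<^sub>v u) (B *\<^sub>v w) $ i" by simp
qed

lemma vec_norm2_kronecker_vec: "vec_norm2 (kronecker_vec u w) = vec_norm2 u * vec_norm2 w"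
proof -
  define n q where "n = dim_vec u" and "q = dim_vec w"
  have u: "u \<in> carrier_vec n" and w: "w \<in> carrier_vec q" by (auto simp: n_def q_def)
  have "kronecker_vec u w \<bullet> kronecker_vec u w =
      (\<Sum>j\<in>{0..<n}. \<Sum>l\<in>{0..<q}. (u $ j * w $ l) * (u $ j * w $ l))"
    unfolding scalar_prod_def carrier_vecD[OF kronecker_vec_carrier[OF u w]] sum_block_index
    by (simp add: kronecker_vec_index[OF u w])
  also have "\<dots> = (u \<bullet> u) * (w \<bullet> w)"
    unfolding scalar_prod_def sum_product carrier_vecD[OF u] carrier_vecD[OF w]
    by (simp add: mult_ac)
  finally show ?thesis by (simp add: vec_norm2_def real_sqrt_mult)
qed

lemma kronecker_vec_smult:
  "kronecker_vec (a \<cdot>\<^sub>v u) (b \<cdot>\<^sub>v w) = (a * b) \<cdot>\<^sub>v kronecker_vec u w"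
  by (rule eq_vecI) (auto simp: kronecker_vec_def block_index_div_mod)

section \<open>Gram matrices of block rows and the Moore--Penrose inverse\<close>

lemma block_row_dim [simp]: "dim_row (block_row r As) = r"
  by (simp add: block_row_def)

text \<open>The product of a matrix with its transpose is a sum over columns, so concatenating lists
  of columns adds these products. In this form there is no need to locate the block that a column
  index belongs to.\<close>

lemma mat_of_cols_gram_index:
  assumes "i < r" "j < r"
  shows "(mat_of_cols r cs * transpose_mat (mat_of_cols r cs)) $$ (i, j) = (\<Sum>c\<leftarrow>cs. c $ i * c $ j)"
  using assms
  by (simp add: scalar_prod_def mat_of_cols_index sum_list_sum_nth)

lemma block_row_gram_Nil: "block_row r [] * transpose_mat (block_row r []) = 0\<^sub>m r r"
  by (rule eq_matI) (auto simp: block_row_def scalar_prod_def)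

lemma block_row_gram_Cons:
  assumes A: "A \<in> carrier_mat r n"
  shows "block_row r (A # As) * transpose_mat (block_row r (A # As)) =
    A * transpose_mat A + block_row r As * transpose_mat (block_row r As)"
proof (rule eq_matI)
  let ?R = "A * transpose_mat A + block_row r As * transpose_mat (block_row r As)"
  fix i j assume "i < dim_row ?R" "j < dim_col ?R"
  then have ij: "i < r" "j < r" by auto
  have "?R $$ (i, j) = (A * transpose_mat A) $$ (i, j)
      + (block_row r As * transpose_mat (block_row r As)) $$ (i, j)"
    by (rule index_add_mat(1)) (use ij in auto)
  also have "(A * transpose_mat A) $$ (i, j) = (\<Sum>c\<leftarrow>cols A. c $ i * c $ j)"
    using mat_of_cols_gram_index[OF ij, of "cols A"] mat_of_cols_cols[of A] A by simp
  also have "(block_row r As * transpose_mat (block_row r As)) $$ (i, j)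
      = (\<Sum>c\<leftarrow>concat (map cols As). c $ i * c $ j)"
    unfolding block_row_def by (rule mat_of_cols_gram_index[OF ij])
  also have "(\<Sum>c\<leftarrow>cols A. c $ i * c $ j) + \<dots> =
      (block_row r (A # As) * transpose_mat (block_row r (A # As))) $$ (i, j)"
    unfolding block_row_def mat_of_cols_gram_index[OF ij] by simp
  finally show "(block_row r (A # As) * transpose_mat (block_row r (A # As))) $$ (i, j) = ?R $$ (i, j)" ..
qed (use A in auto)

lemma block_row_gram_mult_vec_le:
  assumes "\<And>A. A \<in> set As \<Longrightarrow> dim_row A = r"
    and "\<And>A. A \<in> set As \<Longrightarrow> vec_norm2 (A * transpose_mat A *\<^sub>v v) \<le> c * vec_norm2 v"
    and v: "v \<in> carrier_vec r"
  shows "vec_norm2 (block_row r As * transpose_mat (block_row r As) *\<^sub>v v) \<le> real (length As) * c * vec_norm2 v"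
  using assms(1,2)
proof (induction As)
  case Nil
  have "0\<^sub>m r r *\<^sub>v v = 0\<^sub>v r" using v by (intro eq_vecI) auto
  then show ?case unfolding block_row_gram_Nil by (simp add: vec_norm2_def)
next
  case (Cons A As)
  have A: "A \<in> carrier_mat r (dim_col A)" using Cons.prems(1)[of A] by auto
  let ?K = "block_row r As * transpose_mat (block_row r As)"
  have AA: "A * transpose_mat A \<in> carrier_mat r r"
    by (rule mult_carrier_mat[OF A]) (simp only: transpose_carrier_mat A)
  have K: "?K \<in> carrier_mat r r" by (rule carrier_matI) auto
  have "vec_norm2 (block_row r (A # As) * transpose_mat (block_row r (A # As)) *\<^sub>v v)
      = vec_norm2 (A * transpose_mat A *\<^sub>v v + ?K *\<^sub>v v)"
    unfolding block_row_gram_Cons[OF A] add_mult_distrib_mat_vec[OF AA K v] ..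
  also have "\<dots> \<le> vec_norm2 (A * transpose_mat A *\<^sub>v v) + vec_norm2 (?K *\<^sub>v v)"
    by (rule vec_norm2_triangle[OF mult_mat_vec_carrier[OF AA v] mult_mat_vec_carrier[OF K v]])
  also have "\<dots> \<le> c * vec_norm2 v + real (length As) * c * vec_norm2 v"
    by (intro add_mono Cons.IH) (use Cons.prems in auto)
  finally show ?case by (simp add: algebra_simps)
qed

text \<open>The eigenvalues add up because one vector \<open>v\<close> serves all blocks. For such a
  vector the triangle inequality behind \<open>block_row_gram_mult_vec_le\<close> has no
  slack.\<close>

lemma block_row_gram_mult_vec_eq:
  assumes "\<And>A. A \<in> set As \<Longrightarrow> dim_row A = r"
    and "\<And>A. A \<in> set As \<Longrightarrow> A * transpose_mat A *\<^sub>v v = c \<cdot>\<^sub>v v"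
    and v: "v \<in> carrier_vec r"
  shows "block_row r As * transpose_mat (block_row r As) *\<^sub>v v = (real (length As) * c) \<cdot>\<^sub>v v"
  using assms(1,2)
proof (induction As)
  case Nil
  show ?case unfolding block_row_gram_Nil using v by (intro eq_vecI) auto
next
  case (Cons A As)
  have A: "A \<in> carrier_mat r (dim_col A)" using Cons.prems(1)[of A] by auto
  let ?K = "block_row r As * transpose_mat (block_row r As)"
  have AA: "A * transpose_mat A \<in> carrier_mat r r"
    by (rule mult_carrier_mat[OF A]) (simp only: transpose_carrier_mat A)
  have K: "?K \<in> carrier_mat r r" by (rule carrier_matI) auto
  have "A * transpose_mat A *\<^sub>v v = c \<cdot>\<^sub>v v" and "?K *\<^sub>v v = (real (length As) * c) \<cdot>\<^sub>v v"
    using Cons by auto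
  then show ?case
    unfolding block_row_gram_Cons[OF A] add_mult_distrib_mat_vec[OF AA K v]
    by (simp add: add_smult_distrib_vec[symmetric] algebra_simps)
qed

text \<open>Penrose's argument. The symmetry conditions make \<open>A * C * (A * B)\<close> the
  transpose of \<open>A * B * (A * C)\<close>, which forces \<open>A * B = A * C\<close>; likewise
  \<open>B * A = C * A\<close>, and then \<open>B = B * A * C = C\<close>. Uniqueness lets the
  description in \<open>moore_penrose\<close> be evaluated at a candidate.\<close>

lemma is_moore_penrose_unique:
  assumes B: "is_moore_penrose A B" and C: "is_moore_penrose A C"
  shows "B = C"
proof -
  define m n where "m = dim_row A" and "n = dim_col A"
  have c: "A \<in> carrier_mat m n" "B \<in> carrier_mat n m" "C \<in> carrier_mat n m"
    using B C unfolding is_moore_penrose_def m_def n_def by auto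
  note prods = mult_carrier_mat[OF c(1,2)] mult_carrier_mat[OF c(1,3)]
    mult_carrier_mat[OF c(2,1)] mult_carrier_mat[OF c(3,1)]
  have mp: "A * B * A = A" "B * A * B = B" "transpose_mat (A * B) = A * B" "transpose_mat (B * A) = B * A"
    "A * C * A = A" "C * A * C = C" "transpose_mat (A * C) = A * C" "transpose_mat (C * A) = C * A"
    using B C unfolding is_moore_penrose_def by auto
  have "A * B = (A * C) * (A * B)"
    using mp(5) assoc_mult_mat[OF prods(2) c(1,2)] by simp
  also have "\<dots> = transpose_mat ((A * B) * (A * C))"
    by (subst transpose_mult[OF prods(1,2)]) (simp add: mp)
  also have "(A * B) * (A * C) = A * C"
    using mp(1) assoc_mult_mat[OF prods(1) c(1,3)] by simp
  finally have AB: "A * B = A * C" using mp(7) by simp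
  have "B * A = (B * A) * (C * A)"
    using mp(5) assoc_mult_mat[OF c(2,1) prods(4)] assoc_mult_mat[OF c(1,3,1)] by simp
  also have "\<dots> = transpose_mat ((C * A) * (B * A))"
    by (subst transpose_mult[OF prods(4,3)]) (simp add: mp)
  also have "(C * A) * (B * A) = C * A"
    using mp(1) assoc_mult_mat[OF c(3,1) prods(3)] assoc_mult_mat[OF c(1,2,1)] by simp
  finally have BA: "B * A = C * A" using mp(8) by simp
  have "B = B * (A * C)" using mp(2) assoc_mult_mat[OF c(2,1,2)] unfolding AB by simp
  also have "\<dots> = C * A * C" using assoc_mult_mat[OF c(2,1,3)] unfolding BA by simp
  finally show ?thesis unfolding mp(6) .
qed

lemma moore_penrose_eqI:
  assumes "is_moore_penrose A B"
  shows "moore_penrose A = B"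
  unfolding moore_penrose_def using assms is_moore_penrose_unique by (intro the_equality) auto

lemma layer_prod_empty: "b < a \<Longrightarrow> layer_prod d W a b = 1\<^sub>m (d (a - 1))"
  unfolding layer_prod_def by simp

lemma layer_prod_Suc:
  "a \<le> Suc b \<Longrightarrow> layer_prod d W a (Suc b) = layer_prod d W a b * transpose_mat (W (Suc b))"
  unfolding layer_prod_def by simp

section \<open>Balanced deep linear networks\<close>

lemma spectral_norm_transpose:
  assumes A: "A \<in> carrier_mat m n" and m: "m \<ge> 1" and n: "n \<ge> 1"
  shows "spectral_norm (transpose_mat A) = spectral_norm A"
  using spectral_norm_eq_singular_value[OF A m n] spectral_norm_eq_singular_value[of "transpose_mat A" n m]
    singular_value_transpose[OF A, of 1] A m n by simp

text \<open>Matrix powers append their factors on the right, while the induction for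
  \<open>layer_prod_gram\<close> produces them on the left.\<close>

lemma pow_mat_Suc_left:
  assumes A: "A \<in> carrier_mat n n"
  shows "A * A ^\<^sub>m k = A ^\<^sub>m Suc k"
proof (induction k)
  case (Suc k)
  have "A * A ^\<^sub>m Suc k = A * A ^\<^sub>m k * A"
    using assoc_mult_mat[OF A pow_carrier_mat[OF A, of k] A] by simp
  then show ?case unfolding Suc by simp
qed (use A in simp)

text \<open>Contains the weights but no data, so that the kernel can be computed for balanced
  weights in terms of their common spectral norm before the least-squares condition determines that
  norm.\<close>

locale balanced_network =
  fixes L :: nat and d :: "nat \<Rightarrow> nat" and W :: "nat \<Rightarrow> real mat"
  assumes L: "L \<ge> 1"
    and d: "\<And>l. l \<le> L \<Longrightarrow> d l \<ge> 1"
    and W: "\<And>l. l \<in> {1..L} \<Longrightarrow> W l \<in> carrier_mat (d l) (d (l - 1))"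
    and balanced: "\<And>l. l \<in> {1..L - 1} \<Longrightarrow>
           W l * transpose_mat (W l) = transpose_mat (W (l + 1)) * W (l + 1)"
begin

lemma W_Suc: "Suc l \<le> L \<Longrightarrow> W (Suc l) \<in> carrier_mat (d (Suc l)) (d l)"
  using W[of "Suc l"] by simp

lemma WT_Suc: "Suc l \<le> L \<Longrightarrow> transpose_mat (W (Suc l)) \<in> carrier_mat (d l) (d (Suc l))"
  using W_Suc by simp

lemma gram_carrier: "Suc l \<le> L \<Longrightarrow> transpose_mat (W (Suc l)) * W (Suc l) \<in> carrier_mat (d l) (d l)"
  using mult_carrier_mat[OF WT_Suc W_Suc] .

text \<open>The range from \<open>Suc a\<close> to \<open>a + k\<close> makes \<open>k\<close> the
  number of factors, so that inductions on \<open>k\<close> start at the empty product and avoid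
  subtraction on natural numbers.\<close>

lemma layer_prod_carrier: "a + k \<le> L \<Longrightarrow> layer_prod d W (Suc a) (a + k) \<in> carrier_mat (d a) (d (a + k))"
proof (induction k)
  case (Suc k)
  then show ?case using mult_carrier_mat[OF _ WT_Suc, of _ "d a" "a + k"] by (simp add: layer_prod_Suc)
qed (simp add: layer_prod_empty)

text \<open>Balancedness replaces the Gram matrix of a layer by the product of the layer below with
  its transpose; swapping these two factors may change the size but not the nonzero
  spectrum.\<close>

lemma nonzero_eigenvalues_layer:
  "Suc l \<le> L \<Longrightarrow> nonzero_eigenvalues (transpose_mat (W (Suc l)) * W (Suc l))
    = nonzero_eigenvalues (transpose_mat (W 1) * W 1)"
proof (induction l)
  case (Suc l)
  have "nonzero_eigenvalues (transpose_mat (W (Suc (Suc l))) * W (Suc (Suc l)))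
      = nonzero_eigenvalues (W (Suc l) * transpose_mat (W (Suc l)))"
    using balanced[of "Suc l"] Suc.prems by simp
  also have "\<dots> = nonzero_eigenvalues (transpose_mat (W (Suc l)) * W (Suc l))"
    by (rule nonzero_eigenvalues_mult_swap[OF W_Suc WT_Suc]) (use Suc.prems in auto)
  finally show ?case using Suc by simp
qed simp

text \<open>One layer is crossed at a time by associativity,
  \<open>A\<^sup>T (A A\<^sup>T) = (A\<^sup>T A) A\<^sup>T\<close>, where balancedness supplies the
  bracket on the left. The Gram matrix thus travels from the current layer to the input and adapts
  its size on the way.\<close>

lemma layer_prod_intertwine:
  "Suc k \<le> L \<Longrightarrow> layer_prod d W (Suc 0) k * (transpose_mat (W (Suc k)) * W (Suc k))
    = transpose_mat (W 1) * W 1 * layer_prod d W (Suc 0) k"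
proof (induction k)
  case 0
  have G: "transpose_mat (W 1) * W 1 \<in> carrier_mat (d 0) (d 0)" using gram_carrier[of 0] 0 by simp
  show ?case using left_mult_one_mat[OF G] right_mult_one_mat[OF G] by (simp add: layer_prod_empty)
next
  case (Suc k)
  let ?P = "layer_prod d W (Suc 0) k" and ?A = "W (Suc k)"
  have P: "?P \<in> carrier_mat (d 0) (d k)" using layer_prod_carrier[of 0 k] Suc.prems by simp
  have A: "?A \<in> carrier_mat (d (Suc k)) (d k)" and AT: "transpose_mat ?A \<in> carrier_mat (d k) (d (Suc k))"
    using W_Suc WT_Suc Suc.prems by auto
  have G: "transpose_mat (W 1) * W 1 \<in> carrier_mat (d 0) (d 0)" using gram_carrier[of 0] Suc.prems by simp
  have "?P * transpose_mat ?A * (transpose_mat (W (Suc (Suc k))) * W (Suc (Suc k)))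
      = ?P * transpose_mat ?A * (?A * transpose_mat ?A)"
    using balanced[of "Suc k"] Suc.prems by simp
  also have "\<dots> = ?P * (transpose_mat ?A * (?A * transpose_mat ?A))"
    by (rule assoc_mult_mat[OF P AT mult_carrier_mat[OF A AT]])
  also have "\<dots> = ?P * (transpose_mat ?A * ?A * transpose_mat ?A)"
    by (simp only: assoc_mult_mat[OF AT A AT])
  also have "\<dots> = ?P * (transpose_mat ?A * ?A) * transpose_mat ?A"
    by (rule assoc_mult_mat[OF P mult_carrier_mat[OF AT A] AT, symmetric])
  also have "\<dots> = transpose_mat (W 1) * W 1 * ?P * transpose_mat ?A" using Suc by simp
  also have "\<dots> = transpose_mat (W 1) * W 1 * (?P * transpose_mat ?A)"
    by (rule assoc_mult_mat[OF G P AT])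
  finally show ?case by (simp add: layer_prod_Suc)
qed

lemma layer_prod_gram:
  "k \<le> L \<Longrightarrow> layer_prod d W (Suc 0) k * transpose_mat (layer_prod d W (Suc 0) k)
    = (transpose_mat (W 1) * W 1) ^\<^sub>m k"
proof (induction k)
  case 0
  then show ?case using gram_carrier[of 0] W[of 1] L by (simp add: layer_prod_empty)
next
  case (Suc k)
  let ?P = "layer_prod d W (Suc 0) k" and ?A = "W (Suc k)" and ?G = "transpose_mat (W 1) * W 1"
  have P: "?P \<in> carrier_mat (d 0) (d k)" using layer_prod_carrier[of 0 k] Suc.prems by simp
  then have PT: "transpose_mat ?P \<in> carrier_mat (d k) (d 0)" by simp
  have A: "?A \<in> carrier_mat (d (Suc k)) (d k)" and AT: "transpose_mat ?A \<in> carrier_mat (d k) (d (Suc k))"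
    using W_Suc WT_Suc Suc.prems by auto
  have G: "?G \<in> carrier_mat (d 0) (d 0)" using gram_carrier[of 0] Suc.prems by simp
  have "?P * transpose_mat ?A * transpose_mat (?P * transpose_mat ?A)
      = ?P * transpose_mat ?A * (?A * transpose_mat ?P)"
    unfolding transpose_mult[OF P AT] by simp
  also have "\<dots> = ?P * (transpose_mat ?A * (?A * transpose_mat ?P))"
    by (rule assoc_mult_mat[OF P AT mult_carrier_mat[OF A PT]])
  also have "\<dots> = ?P * (transpose_mat ?A * ?A * transpose_mat ?P)"
    by (simp only: assoc_mult_mat[OF AT A PT])
  also have "\<dots> = ?P * (transpose_mat ?A * ?A) * transpose_mat ?P"
    by (rule assoc_mult_mat[OF P mult_carrier_mat[OF AT A] PT, symmetric])
  \<comment> \<open>The inner Gram matrix is pushed to the input end, so that every layer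
    contributes one factor \<open>?G\<close>.\<close>
  also have "\<dots> = ?G * ?P * transpose_mat ?P"
    using layer_prod_intertwine[of k] Suc.prems by simp
  also have "\<dots> = ?G * (?P * transpose_mat ?P)" by (rule assoc_mult_mat[OF G P PT])
  also have "\<dots> = ?G ^\<^sub>m Suc k" using Suc pow_mat_Suc_left[OF G] by simp
  finally show ?case by (simp add: layer_prod_Suc)
qed

text \<open>The counterpart of \<open>layer_prod_gram_eigenvector\<close> at the output end. Peeling
  off the last layer replaces \<open>u\<close> by its image under the transposed weights, for which
  balancedness yields the same equation one layer below. The case \<open>k = 0\<close> is split off
  because the product is empty there and \<open>W (a + k)\<close> is not one of its factors.\<close>

lemma layer_prod_cogram_eigenvector:
  assumes "a + k \<le> L" "u \<in> carrier_vec (d (a + k))"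
    and "k = 0 \<or> W (a + k) * transpose_mat (W (a + k)) *\<^sub>v u = c \<cdot>\<^sub>v u"
  shows "transpose_mat (layer_prod d W (Suc a) (a + k)) *\<^sub>v (layer_prod d W (Suc a) (a + k) *\<^sub>v u)
    = c ^ k \<cdot>\<^sub>v u"
  using assms
proof (induction k arbitrary: u)
  case 0
  then show ?case by (simp add: layer_prod_empty)
next
  case (Suc k)
  let ?Q = "layer_prod d W (Suc a) (a + k)" and ?A = "W (Suc (a + k))"
  let ?x = "transpose_mat ?A *\<^sub>v u"
  have Q: "?Q \<in> carrier_mat (d a) (d (a + k))" using layer_prod_carrier[of a k] Suc.prems by simp
  have A: "?A \<in> carrier_mat (d (Suc (a + k))) (d (a + k))"
    and AT: "transpose_mat ?A \<in> carrier_mat (d (a + k)) (d (Suc (a + k)))"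
    using W_Suc WT_Suc Suc.prems by auto
  have u: "u \<in> carrier_vec (d (Suc (a + k)))" using Suc.prems by simp
  have x: "?x \<in> carrier_vec (d (a + k))" by (rule mult_mat_vec_carrier[OF AT u])
  have Ax: "?A *\<^sub>v ?x = c \<cdot>\<^sub>v u"
    using Suc.prems(3) assoc_mult_mat_vec[OF A AT u] by simp
  \<comment> \<open>Only the equation is passed on and \<open>?x\<close> may be the zero vector, so
    \<open>c = 0\<close> is no exception.\<close>
  have "k = 0 \<or> W (a + k) * transpose_mat (W (a + k)) *\<^sub>v ?x = c \<cdot>\<^sub>v ?x"
  proof (cases k)
    case (Suc j)
    have "W (a + k) * transpose_mat (W (a + k)) = transpose_mat ?A * ?A"
      using balanced[of "a + k"] Suc.prems(1) Suc by simp
    then show ?thesis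
      by (simp add: assoc_mult_mat_vec[OF AT A x] Ax mult_mat_vec[OF AT u])
  qed simp
  from Suc.IH[OF _ x this] Suc.prems(1)
  have QQ: "transpose_mat ?Q *\<^sub>v (?Q *\<^sub>v ?x) = c ^ k \<cdot>\<^sub>v ?x" by simp
  have QT: "transpose_mat ?Q \<in> carrier_mat (d (a + k)) (d a)" using Q by simp
  have "transpose_mat (?Q * transpose_mat ?A) *\<^sub>v (?Q * transpose_mat ?A *\<^sub>v u)
      = ?A * transpose_mat ?Q *\<^sub>v (?Q *\<^sub>v ?x)"
    unfolding transpose_mult[OF Q AT] assoc_mult_mat_vec[OF Q AT u] by simp
  also have "\<dots> = ?A *\<^sub>v (transpose_mat ?Q *\<^sub>v (?Q *\<^sub>v ?x))"
    by (rule assoc_mult_mat_vec[OF A QT mult_mat_vec_carrier[OF Q x]])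
  also have "\<dots> = c ^ k \<cdot>\<^sub>v (?A *\<^sub>v ?x)" unfolding QQ by (rule mult_mat_vec[OF A x])
  also have "\<dots> = c ^ Suc k \<cdot>\<^sub>v u" unfolding Ax by (simp add: smult_smult_assoc mult.commute)
  finally show ?case by (simp add: layer_prod_Suc)
qed

lemma layer_prod_gram_eigenvector:
  assumes k: "k \<le> L" and p: "p \<in> carrier_vec (d 0)" and e: "transpose_mat (W 1) * W 1 *\<^sub>v p = c \<cdot>\<^sub>v p"
  shows "layer_prod d W (Suc 0) k *\<^sub>v (transpose_mat (layer_prod d W (Suc 0) k) *\<^sub>v p) = c ^ k \<cdot>\<^sub>v p"
proof -
  let ?P = "layer_prod d W (Suc 0) k" and ?G = "transpose_mat (W 1) * W 1"
  have P: "?P \<in> carrier_mat (d 0) (d k)" using layer_prod_carrier[of 0 k] k by simp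
  then have PT: "transpose_mat ?P \<in> carrier_mat (d k) (d 0)" by simp
  have G: "?G \<in> carrier_mat (d 0) (d 0)" using gram_carrier[of 0] L by simp
  have "?G ^\<^sub>m j *\<^sub>v p = c ^ j \<cdot>\<^sub>v p" for j
  proof (induction j)
    case (Suc j)
    have "?G ^\<^sub>m Suc j *\<^sub>v p = ?G ^\<^sub>m j *\<^sub>v (?G *\<^sub>v p)"
      using assoc_mult_mat_vec[OF pow_carrier_mat[OF G] G p] by simp
    also have "\<dots> = c \<cdot>\<^sub>v (?G ^\<^sub>m j *\<^sub>v p)" unfolding e by (rule mult_mat_vec[OF pow_carrier_mat[OF G] p])
    finally show ?case unfolding Suc by (simp add: smult_smult_assoc)
  qed (use W_Suc[of 0] L p in simp)
  then show ?thesis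
    using assoc_mult_mat_vec[OF P PT p] layer_prod_gram[OF k] by simp
qed

text \<open>Submultiplicativity one layer at a time. The product and its transpose share the
  constant because transposition keeps the spectral norm of each layer.\<close>

lemma layer_prod_bounds:
  assumes \<sigma>: "\<And>l. Suc l \<le> L \<Longrightarrow> spectral_norm (W (Suc l)) = \<sigma>" "\<sigma> \<ge> 0"
    and k: "a + k \<le> L"
  shows "x \<in> carrier_vec (d (a + k)) \<Longrightarrow> vec_norm2 (layer_prod d W (Suc a) (a + k) *\<^sub>v x) \<le> \<sigma> ^ k * vec_norm2 x"
    and "y \<in> carrier_vec (d a) \<Longrightarrow> vec_norm2 (transpose_mat (layer_prod d W (Suc a) (a + k)) *\<^sub>v y) \<le> \<sigma> ^ k * vec_norm2 y"
  using k
proof (induction k arbitrary: x y)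
  case 0
  {
    case 1
    then show ?case by (simp add: layer_prod_empty)
  next
    case 2
    then show ?case by (simp add: layer_prod_empty)
  }
next
  case (Suc k)
  let ?Q = "layer_prod d W (Suc a) (a + k)" and ?A = "W (Suc (a + k))"
  {
    fix z assume k: "a + Suc k \<le> L"
    have Q: "?Q \<in> carrier_mat (d a) (d (a + k))" using layer_prod_carrier[of a k] k by simp
    then have QT: "transpose_mat ?Q \<in> carrier_mat (d (a + k)) (d a)" by simp
    have A: "?A \<in> carrier_mat (d (Suc (a + k))) (d (a + k))"
      and AT: "transpose_mat ?A \<in> carrier_mat (d (a + k)) (d (Suc (a + k)))"
      using W_Suc WT_Suc k by auto
    have dd: "d (a + k) \<ge> 1" "d (Suc (a + k)) \<ge> 1" using d[of "a + k"] d[of "Suc (a + k)"] k by auto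
    have sA: "spectral_norm ?A = \<sigma>" "spectral_norm (transpose_mat ?A) = \<sigma>"
      using \<sigma>(1)[of "a + k"] spectral_norm_transpose[OF A dd(2,1)] k by auto
    note Q QT A AT dd sA
  } note facts = this
  {
    case 1
    note f = facts[OF 1(2)]
    have x: "x \<in> carrier_vec (d (Suc (a + k)))" using 1 by simp
    have Ax: "transpose_mat ?A *\<^sub>v x \<in> carrier_vec (d (a + k))" by (rule mult_mat_vec_carrier[OF f(4) x])
    have "vec_norm2 (?Q *\<^sub>v (transpose_mat ?A *\<^sub>v x)) \<le> \<sigma> ^ k * vec_norm2 (transpose_mat ?A *\<^sub>v x)"
      using Suc.IH(1)[OF Ax] 1 by simp
    also have "\<dots> \<le> \<sigma> ^ k * (\<sigma> * vec_norm2 x)"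
      using spectral_norm_bound[OF f(4,5,6) x] \<sigma>(2) f(8) by (intro mult_left_mono) auto
    finally show ?case using assoc_mult_mat_vec[OF f(1,4) x] by (simp add: layer_prod_Suc mult_ac)
  next
    case (2 y)
    note f = facts[OF 2(2)]
    have y: "y \<in> carrier_vec (d a)" using 2 by simp
    have Qy: "transpose_mat ?Q *\<^sub>v y \<in> carrier_vec (d (a + k))" by (rule mult_mat_vec_carrier[OF f(2) y])
    have "vec_norm2 (?A *\<^sub>v (transpose_mat ?Q *\<^sub>v y)) \<le> \<sigma> * vec_norm2 (transpose_mat ?Q *\<^sub>v y)"
      using spectral_norm_bound[OF f(3,6,5) Qy] f(7) by simp
    also have "\<dots> \<le> \<sigma> * (\<sigma> ^ k * vec_norm2 y)"
      using Suc.IH(2)[OF y] 2 \<sigma>(2) by (intro mult_left_mono) auto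
    finally show ?case
      using assoc_mult_mat_vec[OF f(3,2) y] transpose_mult[OF f(1,4)] by (simp add: layer_prod_Suc mult_ac)
  }
qed

section \<open>The Jacobian blocks and the top eigenvalue of the kernel\<close>

lemma prefix_prod_carrier:
  assumes "l \<in> {1..L}"
  shows "prefix_prod d W l \<in> carrier_mat (d 0) (d (l - 1))"
proof -
  have "l - 1 \<le> L" using assms by auto
  then show ?thesis using layer_prod_carrier[of 0 "l - 1"] by (simp add: prefix_prod_def)
qed

lemma jacobian_layer_carrier:
  assumes X: "X \<in> carrier_mat n (d 0)" and l: "l \<in> {1..L}"
  shows "suffix_prod d L W l \<in> carrier_mat (d l) (d L)"
    and "X * prefix_prod d W l \<in> carrier_mat n (d (l - 1))"
    and "jacobian_layer d L W X l \<in> carrier_mat (d L * n) (d l * d (l - 1))"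
proof -
  show S: "suffix_prod d L W l \<in> carrier_mat (d l) (d L)"
    using layer_prod_carrier[of l "L - l"] l by (simp add: suffix_prod_def)
  show XP: "X * prefix_prod d W l \<in> carrier_mat n (d (l - 1))"
    by (rule mult_carrier_mat[OF X prefix_prod_carrier[OF l]])
  show "jacobian_layer d L W X l \<in> carrier_mat (d L * n) (d l * d (l - 1))"
    unfolding jacobian_layer_def by (rule kronecker_carrier) (use S XP in auto)
qed

text \<open>The data enter through three properties. \<open>X_le\<close> and \<open>XT_le\<close>
  give the upper bound; \<open>X_pair\<close> provides for every \<open>p\<close> a partner
  \<open>w\<close> among the sample vectors, so that \<open>X\<close> attains its norm in whichever
  direction the weights prefer. The bound and a common eigenvector of all layer terms then pin down
  the kernel.\<close>

lemma ntk_lambda_max: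
  fixes X :: "real mat"
  assumes n: "n \<ge> 1" and X: "X \<in> carrier_mat n (d 0)" and s: "s \<ge> 0"
    and X_le: "\<And>v. v \<in> carrier_vec (d 0) \<Longrightarrow> vec_norm2 (X *\<^sub>v v) \<le> s * vec_norm2 v"
    and XT_le: "\<And>w. w \<in> carrier_vec n \<Longrightarrow> vec_norm2 (transpose_mat X *\<^sub>v w) \<le> s * vec_norm2 w"
    and X_pair: "\<And>p. p \<in> carrier_vec (d 0) \<Longrightarrow> \<exists>w \<in> carrier_vec n. vec_norm2 w = vec_norm2 p
        \<and> X *\<^sub>v p = s \<cdot>\<^sub>v w \<and> transpose_mat X *\<^sub>v w = s \<cdot>\<^sub>v p"
    and \<sigma>: "\<And>l. Suc l \<le> L \<Longrightarrow> spectral_norm (W (Suc l)) = \<sigma>"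
  shows "spectral_norm (ntk d L W X) = real L * s\<^sup>2 * \<sigma> ^ (2 * (L - 1)) / real n"
    and "lambda_max (ntk d L W X) = real L * s\<^sup>2 * \<sigma> ^ (2 * (L - 1)) / real n"
proof -
  let ?c = "s\<^sup>2 * \<sigma> ^ (2 * (L - 1))" and ?N = "d L * n"
  let ?Js = "map (jacobian_layer d L W X) [1..<Suc L]"
  have Js: "\<exists>l \<in> {1..L}. A = jacobian_layer d L W X l" if "A \<in> set ?Js" for A
    using that by auto
  have W1: "W 1 \<in> carrier_mat (d 1) (d 0)" and WL: "W L \<in> carrier_mat (d L) (d (L - 1))"
    using W[of 1] W[of L] L by auto
  have dp: "d 0 \<ge> 1" "d 1 \<ge> 1" "d L \<ge> 1" "d (L - 1) \<ge> 1"
    using d[of 0] d[of 1] d[of L] d[of "L - 1"] L by auto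
  have \<sigma>1: "spectral_norm (W 1) = \<sigma>" and \<sigma>L: "spectral_norm (W L) = \<sigma>"
    using \<sigma>[of 0] \<sigma>[of "L - 1"] L by auto
  have \<sigma>0: "\<sigma> \<ge> 0" using spectral_norm_nonneg[OF W1 dp(2,1)] \<sigma>1 by simp
  have c0: "?c \<ge> 0" using s \<sigma>0 by simp
  have dim: "dim_row A = ?N" if "A \<in> set ?Js" for A
    using Js[OF that] jacobian_layer_carrier(3)[OF X] by fastforce

  have layer_le: "vec_norm2 (A * transpose_mat A *\<^sub>v v) \<le> ?c * vec_norm2 v"
    if A: "A \<in> set ?Js" and v: "v \<in> carrier_vec ?N" for A v
  proof -
    obtain l where l: "l \<in> {1..L}" and Al: "A = jacobian_layer d L W X l" using Js[OF A] by blast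
    let ?S = "suffix_prod d L W l" and ?P = "prefix_prod d W l"
    have S: "?S \<in> carrier_mat (d l) (d L)" and XP: "X * ?P \<in> carrier_mat n (d (l - 1))"
      and J: "A \<in> carrier_mat ?N (d l * d (l - 1))"
      using jacobian_layer_carrier[OF X l] unfolding Al by auto
    have l1: "l - 1 \<le> L" using l by auto
    have ST: "transpose_mat ?S \<in> carrier_mat (d L) (d l)" using S by simp
    have XPT: "transpose_mat (X * ?P) \<in> carrier_mat (d (l - 1)) n" using XP by simp
    have P: "?P \<in> carrier_mat (d 0) (d (l - 1))" by (rule prefix_prod_carrier[OF l])
    then have PT: "transpose_mat ?P \<in> carrier_mat (d (l - 1)) (d 0)" by simp
    have S_le: "vec_norm2 (?S *\<^sub>v x) \<le> \<sigma> ^ (L - l) * vec_norm2 x" if "x \<in> carrier_vec (d L)" for x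
      using layer_prod_bounds(1)[OF \<sigma> \<sigma>0, of l "L - l" x] l that by (simp add: suffix_prod_def)
    have ST_le: "vec_norm2 (transpose_mat ?S *\<^sub>v x) \<le> \<sigma> ^ (L - l) * vec_norm2 x" if "x \<in> carrier_vec (d l)" for x
      using layer_prod_bounds(2)[OF \<sigma> \<sigma>0, of l "L - l" x] l that by (simp add: suffix_prod_def)
    have P_le: "vec_norm2 (?P *\<^sub>v x) \<le> \<sigma> ^ (l - 1) * vec_norm2 x" if "x \<in> carrier_vec (d (l - 1))" for x
      using layer_prod_bounds(1)[OF \<sigma> \<sigma>0, of 0 "l - 1" x] l1 that by (simp add: prefix_prod_def)
    have PT_le: "vec_norm2 (transpose_mat ?P *\<^sub>v x) \<le> \<sigma> ^ (l - 1) * vec_norm2 x" if "x \<in> carrier_vec (d 0)" for x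
      using layer_prod_bounds(2)[OF \<sigma> \<sigma>0, of 0 "l - 1" x] l1 that by (simp add: prefix_prod_def)
    have XP_le: "vec_norm2 (X * ?P *\<^sub>v x) \<le> s * \<sigma> ^ (l - 1) * vec_norm2 x" if x: "x \<in> carrier_vec (d (l - 1))" for x
    proof -
      have "vec_norm2 (X * ?P *\<^sub>v x) \<le> s * vec_norm2 (?P *\<^sub>v x)"
        using X_le[OF mult_mat_vec_carrier[OF P x]] assoc_mult_mat_vec[OF X P x] by simp
      also have "\<dots> \<le> s * (\<sigma> ^ (l - 1) * vec_norm2 x)"
        by (rule mult_left_mono[OF P_le[OF x] s])
      finally show ?thesis by (simp add: mult.assoc)
    qed
    have XPT_le: "vec_norm2 (transpose_mat (X * ?P) *\<^sub>v x) \<le> s * \<sigma> ^ (l - 1) * vec_norm2 x" if x: "x \<in> carrier_vec n" for x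
    proof -
      have XT: "transpose_mat X \<in> carrier_mat (d 0) n" using X by simp
      have "vec_norm2 (transpose_mat (X * ?P) *\<^sub>v x) \<le> \<sigma> ^ (l - 1) * vec_norm2 (transpose_mat X *\<^sub>v x)"
        using PT_le[OF mult_mat_vec_carrier[OF XT x]] assoc_mult_mat_vec[OF PT XT x] transpose_mult[OF X P]
        by simp
      also have "\<dots> \<le> \<sigma> ^ (l - 1) * (s * vec_norm2 x)"
        by (rule mult_left_mono[OF XT_le[OF x]]) (use \<sigma>0 in simp)
      finally show ?thesis by (simp add: mult_ac)
    qed
    let ?b = "\<sigma> ^ (L - l) * (s * \<sigma> ^ (l - 1))"
    have b0: "\<sigma> ^ (L - l) \<ge> 0" "s * \<sigma> ^ (l - 1) \<ge> 0" using s \<sigma>0 by auto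
    have JT: "transpose_mat A \<in> carrier_mat (d l * d (l - 1)) ?N" using J by simp
    have AT: "transpose_mat A = ?S \<otimes>\<^sub>K transpose_mat (X * ?P)"
      unfolding Al jacobian_layer_def transpose_kronecker by simp
    have "vec_norm2 (A * transpose_mat A *\<^sub>v v) = vec_norm2 (A *\<^sub>v (transpose_mat A *\<^sub>v v))"
      using assoc_mult_mat_vec[OF J JT v] by simp
    also have "\<dots> \<le> ?b * vec_norm2 (transpose_mat A *\<^sub>v v)"
      using vec_norm2_kronecker_le[OF ST XP mult_mat_vec_carrier[OF JT v] ST_le XP_le b0]
      unfolding Al jacobian_layer_def .
    also have "\<dots> \<le> ?b * (?b * vec_norm2 v)"
      using vec_norm2_kronecker_le[OF S XPT v S_le XPT_le b0] b0
      unfolding AT by (intro mult_left_mono) auto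
    \<comment> \<open>The exponents \<open>L - l\<close> and \<open>l - 1\<close> add up to
      \<open>L - 1\<close> for every \<open>l\<close>: each block misses exactly its own layer, so
      all blocks get the same constant.\<close>
    also have "?b = s * \<sigma> ^ (L - 1)"
      using l by (simp add: power_add[symmetric] mult_ac)
    also have "s * \<sigma> ^ (L - 1) * (s * \<sigma> ^ (L - 1) * vec_norm2 v) = ?c * vec_norm2 v"
      by (simp add: power2_eq_square power_mult mult_ac power_mult_distrib)
    finally show ?thesis .
  qed

  from top_singular_value(3)[OF W1 dp(2,1)] obtain p where p: "p \<in> carrier_vec (d 0)" "p \<bullet> p = 1"
    and pe: "transpose_mat (W 1) * W 1 *\<^sub>v p = \<sigma>\<^sup>2 \<cdot>\<^sub>v p"
    using spectral_norm_eq_singular_value[OF W1 dp(2,1)] \<sigma>1 by auto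
  \<comment> \<open>The output direction \<open>u\<close> belongs to
    \<open>W L * transpose_mat (W L)\<close>, which is the Gram matrix of the transpose.\<close>
  have WLT: "transpose_mat (W L) \<in> carrier_mat (d (L - 1)) (d L)" using WL by simp
  from top_singular_value(3)[OF WLT dp(4,3)] obtain u where u: "u \<in> carrier_vec (d L)" "u \<bullet> u = 1"
    and ue: "W L * transpose_mat (W L) *\<^sub>v u = \<sigma>\<^sup>2 \<cdot>\<^sub>v u"
    using spectral_norm_eq_singular_value[OF WLT dp(4,3)] spectral_norm_transpose[OF WL dp(3,4)] \<sigma>L by auto
  from X_pair[OF p(1)] obtain w where w: "w \<in> carrier_vec n" "vec_norm2 w = vec_norm2 p"
    and Xp: "X *\<^sub>v p = s \<cdot>\<^sub>v w" and XTw: "transpose_mat X *\<^sub>v w = s \<cdot>\<^sub>v p" by blast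
  \<comment> \<open>The order of the factors follows the column stacking of the predictions:
    \<open>u\<close> indexes the output coordinates and \<open>w\<close> the samples.\<close>
  let ?z = "kronecker_vec u w"
  have z: "?z \<in> carrier_vec ?N" by (rule kronecker_vec_carrier[OF u(1) w(1)])
  have z1: "vec_norm2 ?z = 1"
    unfolding vec_norm2_kronecker_vec w(2) using u p by (simp add: vec_norm2_def)

  have layer_eq: "A * transpose_mat A *\<^sub>v ?z = ?c \<cdot>\<^sub>v ?z" if A: "A \<in> set ?Js" for A
  proof -
    obtain l where l: "l \<in> {1..L}" and Al: "A = jacobian_layer d L W X l" using Js[OF A] by blast
    let ?S = "suffix_prod d L W l" and ?P = "prefix_prod d W l"
    have S: "?S \<in> carrier_mat (d l) (d L)" and XP: "X * ?P \<in> carrier_mat n (d (l - 1))"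
      and J: "A \<in> carrier_mat ?N (d l * d (l - 1))"
      using jacobian_layer_carrier[OF X l] unfolding Al by auto
    have l1: "l - 1 \<le> L" using l by auto
    have ST: "transpose_mat ?S \<in> carrier_mat (d L) (d l)" using S by simp
    have XPT: "transpose_mat (X * ?P) \<in> carrier_mat (d (l - 1)) n" using XP by simp
    have XT: "transpose_mat X \<in> carrier_mat (d 0) n" using X by simp
    have P: "?P \<in> carrier_mat (d 0) (d (l - 1))" by (rule prefix_prod_carrier[OF l])
    then have PT: "transpose_mat ?P \<in> carrier_mat (d (l - 1)) (d 0)" by simp
    have JT: "transpose_mat A \<in> carrier_mat (d l * d (l - 1)) ?N" using J by simp
    have AT: "transpose_mat A = ?S \<otimes>\<^sub>K transpose_mat (X * ?P)"
      unfolding Al jacobian_layer_def transpose_kronecker by simp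
    \<comment> \<open>Every nonempty suffix ends with layer \<open>L\<close>, so the one equation
      for \<open>u\<close> serves all \<open>l\<close>; for \<open>l = L\<close> the suffix is empty
      and the exponent is 0.\<close>
    have Su: "transpose_mat ?S *\<^sub>v (?S *\<^sub>v u) = (\<sigma>\<^sup>2) ^ (L - l) \<cdot>\<^sub>v u"
      using layer_prod_cogram_eigenvector[of l "L - l" u "\<sigma>\<^sup>2"] l u ue by (simp add: suffix_prod_def)
    have Pp: "?P *\<^sub>v (transpose_mat ?P *\<^sub>v p) = (\<sigma>\<^sup>2) ^ (l - 1) \<cdot>\<^sub>v p"
      using layer_prod_gram_eigenvector[of "l - 1" p "\<sigma>\<^sup>2"] l1 p pe by (simp add: prefix_prod_def)
    have PTp: "transpose_mat ?P *\<^sub>v p \<in> carrier_vec (d (l - 1))" by (rule mult_mat_vec_carrier[OF PT p(1)])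
    have "transpose_mat (X * ?P) *\<^sub>v w = s \<cdot>\<^sub>v (transpose_mat ?P *\<^sub>v p)"
      unfolding transpose_mult[OF X P] assoc_mult_mat_vec[OF PT XT w(1)] XTw by (rule mult_mat_vec[OF PT p(1)])
    then have "X * ?P *\<^sub>v (transpose_mat (X * ?P) *\<^sub>v w) = s \<cdot>\<^sub>v (X *\<^sub>v (?P *\<^sub>v (transpose_mat ?P *\<^sub>v p)))"
      using mult_mat_vec[OF XP PTp, of s] assoc_mult_mat_vec[OF X P PTp] by simp
    also have "\<dots> = (s\<^sup>2 * (\<sigma>\<^sup>2) ^ (l - 1)) \<cdot>\<^sub>v w"
      unfolding Pp mult_mat_vec[OF X p(1)] Xp by (simp add: smult_smult_assoc power2_eq_square mult_ac)
    finally have XPw: "X * ?P *\<^sub>v (transpose_mat (X * ?P) *\<^sub>v w) = \<dots>" .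
    have "A * transpose_mat A *\<^sub>v ?z = A *\<^sub>v (transpose_mat A *\<^sub>v ?z)"
      by (rule assoc_mult_mat_vec[OF J JT z])
    also have "\<dots> = A *\<^sub>v kronecker_vec (?S *\<^sub>v u) (transpose_mat (X * ?P) *\<^sub>v w)"
      unfolding AT kronecker_mult_kronecker_vec[OF S XPT u(1) w(1)] ..
    also have "\<dots> = kronecker_vec (transpose_mat ?S *\<^sub>v (?S *\<^sub>v u)) (X * ?P *\<^sub>v (transpose_mat (X * ?P) *\<^sub>v w))"
      unfolding Al jacobian_layer_def
      by (rule kronecker_mult_kronecker_vec[OF ST XP mult_mat_vec_carrier[OF S u(1)] mult_mat_vec_carrier[OF XPT w(1)]])
    also have "\<dots> = ((\<sigma>\<^sup>2) ^ (L - l) * (s\<^sup>2 * (\<sigma>\<^sup>2) ^ (l - 1))) \<cdot>\<^sub>v ?z"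
      unfolding Su XPw kronecker_vec_smult ..
    also have "(\<sigma>\<^sup>2) ^ (L - l) * (s\<^sup>2 * (\<sigma>\<^sup>2) ^ (l - 1)) = s\<^sup>2 * (\<sigma>\<^sup>2) ^ ((L - l) + (l - 1))"
      unfolding power_add by simp
    also have "(L - l) + (l - 1) = L - 1" using l by auto
    finally show ?thesis by (simp add: power_mult)
  qed

  let ?K = "jacobian d L W X * transpose_mat (jacobian d L W X)"
  have nX: "dim_row X = n" using X by simp
  have Keq: "?K = block_row ?N ?Js * transpose_mat (block_row ?N ?Js)"
    unfolding jacobian_def nX ..
  have K: "?K \<in> carrier_mat ?N ?N" unfolding Keq by (rule carrier_matI) auto
  have ntk: "ntk d L W X \<in> carrier_mat ?N ?N" unfolding ntk_def using K by simp
  have ntk_v: "ntk d L W X *\<^sub>v v = (1 / real n) \<cdot>\<^sub>v (?K *\<^sub>v v)" if "v \<in> carrier_vec ?N" for v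
    unfolding ntk_def nX by (rule eq_vecI) (use K that in auto)
  have len: "length ?Js = L" by simp
  \<comment> \<open>There are \<open>L\<close> equal contributions \<open>?c\<close>, and the
    division by \<open>n\<close> is the normalization of the kernel.\<close>
  let ?C = "real L * ?c / real n"
  have le: "vec_norm2 (ntk d L W X *\<^sub>v v) \<le> ?C * vec_norm2 v" if v: "v \<in> carrier_vec ?N" for v
  proof -
    have "vec_norm2 (?K *\<^sub>v v) \<le> real L * ?c * vec_norm2 v"
      using block_row_gram_mult_vec_le[of ?Js ?N v ?c, OF dim layer_le[OF _ v] v] unfolding Keq len .
    then show ?thesis unfolding ntk_v[OF v] vec_norm2_smult by (simp add: divide_right_mono)
  qed
  have eig: "ntk d L W X *\<^sub>v ?z = ?C \<cdot>\<^sub>v ?z"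
  proof -
    have "?K *\<^sub>v ?z = (real L * ?c) \<cdot>\<^sub>v ?z"
      using block_row_gram_mult_vec_eq[of ?Js ?N ?z ?c, OF dim layer_eq z] unfolding Keq len .
    then show ?thesis unfolding ntk_v[OF z] by (simp add: smult_smult_assoc)
  qed
  have C0: "?C \<ge> 0" using c0 by simp
  show "spectral_norm (ntk d L W X) = real L * s\<^sup>2 * \<sigma> ^ (2 * (L - 1)) / real n"
    using spectral_norm_lambda_max_eqI(1)[OF ntk le z z1 eig C0] by (simp add: mult.assoc)
  show "lambda_max (ntk d L W X) = real L * s\<^sup>2 * \<sigma> ^ (2 * (L - 1)) / real n"
    using spectral_norm_lambda_max_eqI(2)[OF ntk le z z1 eig C0] by (simp add: mult.assoc)
qed

end

section \<open>Networks that implement the least-squares solution\<close>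

lemma frobenius_norm_diff_eq_0:
  assumes A: "A \<in> carrier_mat m n" and B: "B \<in> carrier_mat m n" and 0: "frobenius_norm (A - B) = 0"
  shows "A = B"
proof (rule eq_matI)
  have "(\<Sum>i<m. \<Sum>j<n. ((A - B) $$ (i, j))\<^sup>2) = 0"
    using 0 A B by (simp add: frobenius_norm_def)
  then have *: "\<forall>i<m. \<forall>j<n. (A - B) $$ (i, j) = 0"
    by (simp add: sum_nonneg_eq_0_iff sum_nonneg)
  fix i j assume "i < dim_row B" "j < dim_col B"
  then show "A $$ (i, j) = B $$ (i, j)" using * B by auto
qed (use A B in auto)

lemma nonzero_eigenvalues_orthogonal_conj:
  assumes V: "V \<in> carrier_mat n n" "transpose_mat V * V = 1\<^sub>m n" "V * transpose_mat V = 1\<^sub>m n"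
    and S: "S \<in> carrier_mat n n"
  shows "nonzero_eigenvalues (V * S * transpose_mat V) = nonzero_eigenvalues S"
  by (rule nonzero_eigenvalues_similar, rule similar_matI[of _ _ V "transpose_mat V" n]) (use V S in auto)

section \<open>Real roots and powers\<close>

lemma powr_root_power: "x \<ge> 0 \<Longrightarrow> L \<ge> 1 \<Longrightarrow> (x powr (1 / real L)) ^ L = x"
  by (cases "x = 0") (auto simp: powr_realpow[symmetric] powr_powr)

lemma powr_neg_root_power:
  assumes "s > 0" "L \<ge> 1"
  shows "(s powr (- 1 / real L)) ^ L = 1 / s"
proof -
  have "(s powr (- 1 / real L)) ^ L = s powr ((- 1 / real L) * real L)"
    using assms by (simp only: powr_realpow[symmetric] powr_powr powr_gt_zero)
  also have "(- 1 / real L) * real L = - 1" using assms by simp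
  finally show ?thesis using assms by (simp add: powr_minus_divide)
qed

text \<open>Both sides are nonnegative, so comparing \<open>L\<close>-th powers suffices. The square
  roots pass from eigenvalues of Gram matrices to singular values and remove the square from
  \<open>1 / s\<close>.\<close>

lemma sqrt_eq_scaled_root:
  fixes e f s :: real
  assumes e: "e \<ge> 0" and f: "f \<ge> 0" and s: "s > 0" and L: "L \<ge> 1" and eq: "e ^ L = (1 / s)\<^sup>2 * f"
  shows "sqrt e = s powr (- 1 / real L) * sqrt f powr (1 / real L)"
proof (rule power_eq_imp_eq_base)
  have "(sqrt e) ^ L = sqrt (e ^ L)" by (simp add: real_sqrt_power)
  also have "\<dots> = (1 / s) * sqrt f" unfolding eq using s by (simp add: real_sqrt_mult)
  also have "\<dots> = (s powr (- 1 / real L)) ^ L * (sqrt f powr (1 / real L)) ^ L"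
    using powr_neg_root_power[OF s L] f powr_root_power[OF _ L, of "sqrt f"] by simp
  finally show "(sqrt e) ^ L = (s powr (- 1 / real L) * sqrt f powr (1 / real L)) ^ L"
    by (simp add: power_mult_distrib)
qed (use e L in auto)

text \<open>After inserting \<tau>, the two powers of \<open>s\<^sup>2 / n\<close> combine to
  exponent 1, and \<open>\<sigma> ^ (2 * L)\<close> raised to \<open>1 - 1 / L\<close> leaves
  \<open>\<sigma> ^ (2 * (L - 1))\<close>. For \<open>L \<ge> 2\<close> and \<sigma> = 0 both sides
  vanish.\<close>

lemma ntk_value_eq_rpow:
  fixes s \<sigma> \<tau> :: real
  assumes s: "s > 0" and \<sigma>: "\<sigma> \<ge> 0" and L: "L \<ge> 1" and n: "n \<ge> 1" and \<tau>: "\<tau> = s * \<sigma> ^ L"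
  shows "real L * s\<^sup>2 * \<sigma> ^ (2 * (L - 1)) / real n =
    real L * rpow (s\<^sup>2 / real n) (1 / real L) * rpow (\<tau>\<^sup>2 / real n) (1 - 1 / real L)"
proof (cases "L = 1")
  \<comment> \<open>The second exponent is 0, and \<open>rpow\<close> returns 1 even if \<tau> = 0;
    this matches \<open>\<sigma> ^ 0\<close> on the left.\<close>
  case True
  then show ?thesis using s n by (simp add: rpow_def)
next
  case False
  then have L2: "L \<ge> 2" using L by simp
  show ?thesis
  proof (cases "\<sigma> = 0")
    case True
    moreover have "2 * (L - 1) \<noteq> 0" "L \<noteq> 0" using L2 by auto
    ultimately have "\<sigma> ^ (2 * (L - 1)) = 0" "\<tau> = 0" unfolding \<tau> by (simp_all only: power_0_left if_False mult_zero_right)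
    then show ?thesis using L2 by (simp add: rpow_def)
  next
    case False
    then have \<sigma>0: "\<sigma> > 0" using \<sigma> by simp
    have x0: "s\<^sup>2 / real n > 0" using s n by simp
    let ?a = "1 / real L"
    have t: "\<tau>\<^sup>2 / real n = (s\<^sup>2 / real n) * \<sigma> ^ (2 * L)"
      unfolding \<tau> by (simp add: power_mult_distrib power_mult[symmetric] mult.commute)
    have "rpow (s\<^sup>2 / real n) ?a * rpow (\<tau>\<^sup>2 / real n) (1 - ?a)
        = (s\<^sup>2 / real n) powr ?a * ((s\<^sup>2 / real n) powr (1 - ?a) * (\<sigma> ^ (2 * L)) powr (1 - ?a))"
      unfolding t powr_mult[symmetric] using L2 by (simp add: rpow_def)
    also have "\<dots> = (s\<^sup>2 / real n) powr (?a + (1 - ?a)) * (\<sigma> ^ (2 * L)) powr (1 - ?a)"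
      unfolding powr_add by simp
    also have "(s\<^sup>2 / real n) powr (?a + (1 - ?a)) = s\<^sup>2 / real n" using x0 by simp
    also have "(\<sigma> ^ (2 * L)) powr (1 - ?a) = \<sigma> powr (real (2 * L) * (1 - ?a))"
      using \<sigma>0 by (simp only: powr_realpow[symmetric] powr_powr)
    also have "real (2 * L) * (1 - ?a) = real (2 * (L - 1))"
      using L2 by (simp add: field_simps of_nat_diff)
    also have "\<sigma> powr real (2 * (L - 1)) = \<sigma> ^ (2 * (L - 1))" by (rule powr_realpow[OF \<sigma>0])
    finally show ?thesis by (simp add: mult.assoc)
  qed
qed

lemma rpow_mono: "0 \<le> x \<Longrightarrow> x \<le> y \<Longrightarrow> 0 \<le> a \<Longrightarrow> rpow x a \<le> rpow y a"
  by (simp add: rpow_def powr_mono2)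

lemma rpow_nonneg: "rpow x a \<ge> 0"
  by (simp add: rpow_def)

theorem theorem4:
  fixes L n :: nat and d :: "nat \<Rightarrow> nat"
    and W :: "nat \<Rightarrow> real mat"
    and X Y U V :: "real mat" and s :: real
  assumes L: "L \<ge> 1"
    and n: "n \<ge> 1"
    and d: "\<And>l. l \<le> L \<Longrightarrow> d l \<ge> 1"
    and X: "X \<in> carrier_mat n (d 0)"
    and Y: "Y \<in> carrier_mat n (d L)"
    and W: "\<And>l. l \<in> {1..L} \<Longrightarrow> W l \<in> carrier_mat (d l) (d (l - 1))"
    and n_ge: "n \<ge> d 0"
    and rank_X: "vec_space.rank n X = d 0"
    and U: "U \<in> carrier_mat n (d 0)" "transpose_mat U * U = 1\<^sub>m (d 0)"
    and V: "V \<in> carrier_mat (d 0) (d 0)"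
           "transpose_mat V * V = 1\<^sub>m (d 0)" "V * transpose_mat V = 1\<^sub>m (d 0)"
    and s: "s > 0"
    and svd_X: "X = U * (s \<cdot>\<^sub>m 1\<^sub>m (d 0)) * transpose_mat V"
    and balanced: "\<And>l. l \<in> {1..L - 1} \<Longrightarrow>
           W l * transpose_mat (W l) = transpose_mat (W (l + 1)) * W (l + 1)"
    and ols: "layer_prod d W 1 L = moore_penrose X * Y"
  shows "(\<forall>l \<in> {1..L}. \<forall>i \<in> {1..Min (d ` {0..L})}.
            singular_value (W l) i =
              s powr (- 1 / real L) * singular_value (transpose_mat U * Y) i powr (1 / real L))
       \<and> spectral_norm (ntk d L W X) = lambda_max (ntk d L W X)
       \<and> lambda_max (ntk d L W X) =
            real L * rpow ((spectral_norm X)\<^sup>2 / real n) (1 / real L)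
              * rpow ((spectral_norm (transpose_mat U * Y))\<^sup>2 / real n) (1 - 1 / real L)
       \<and> lambda_max (ntk d L W X) \<le>
            real L * rpow ((spectral_norm X)\<^sup>2 / real n) (1 / real L)
              * rpow ((spectral_norm Y)\<^sup>2 / real n) (1 - 1 / real L)
       \<and> (loss d L W X Y = 0 \<longrightarrow>
            lambda_max (ntk d L W X) =
              real L * rpow ((spectral_norm X)\<^sup>2 / real n) (1 / real L)
                * rpow ((spectral_norm Y)\<^sup>2 / real n) (1 - 1 / real L))"
proof -
  interpret balanced_network L d W
    by unfold_locales (use L d W balanced in auto)
  let ?r = "d 0"
  have UT: "transpose_mat U \<in> carrier_mat ?r n" and VT: "transpose_mat V \<in> carrier_mat ?r ?r"
    using U V by auto
  have dd: "?r \<ge> 1" "d L \<ge> 1" using d by auto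
  \<comment> \<open>The coordinates of the targets after projection to the column space of
    \<open>X\<close>; the least-squares solution depends on \<open>Y\<close> only through
    them.\<close>
  define Z where "Z = transpose_mat U * Y"
  have Z: "Z \<in> carrier_mat ?r (d L)" unfolding Z_def by (rule mult_carrier_mat[OF UT Y])
  then have ZT: "transpose_mat Z \<in> carrier_mat (d L) ?r" by simp
  have UVT: "U * transpose_mat V \<in> carrier_mat n ?r" and VUT: "V * transpose_mat U \<in> carrier_mat ?r n"
    using mult_carrier_mat[OF U(1) VT] mult_carrier_mat[OF V(1) UT] .
  have Xs: "X = s \<cdot>\<^sub>m (U * transpose_mat V)"
    unfolding svd_X using U(1) VT
    by (simp add: mult_smult_distrib[of _ n ?r _ ?r] mult_smult_assoc_mat[OF U(1) VT])

  \<comment> \<open>Inverting the singular value decomposition factor by factor gives the candidate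
    for the pseudoinverse. It is a left inverse of \<open>X\<close>, and \<open>X * B\<close> is the
    orthogonal projection \<open>U U\<^sup>T\<close>, which settles the symmetry conditions.\<close>
  define B where "B = (1 / s) \<cdot>\<^sub>m (V * transpose_mat U)"
  have B: "B \<in> carrier_mat ?r n" unfolding B_def using VUT by simp
  have VU_UV: "V * transpose_mat U * (U * transpose_mat V) = 1\<^sub>m ?r"
  proof -
    have "V * transpose_mat U * (U * transpose_mat V) = V * (transpose_mat U * (U * transpose_mat V))"
      by (rule assoc_mult_mat[OF V(1) UT UVT])
    also have "transpose_mat U * (U * transpose_mat V) = transpose_mat V"
      using assoc_mult_mat[OF UT U(1) VT] VT unfolding U(2) by simp
    finally show ?thesis using V(3) by simp
  qed
  have BX: "B * X = 1\<^sub>m ?r"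
    unfolding B_def Xs mult_smult_assoc_mat[OF VUT smult_carrier_mat[OF UVT]]
      mult_smult_distrib[OF VUT UVT] VU_UV using s by (intro eq_matI) auto
  have XB: "X * B = U * transpose_mat U"
  proof -
    have "X * B = U * transpose_mat V * (V * transpose_mat U)"
      unfolding B_def Xs mult_smult_assoc_mat[OF UVT smult_carrier_mat[OF VUT]]
      mult_smult_distrib[OF UVT VUT] using s by (intro eq_matI) auto
    also have "\<dots> = U * (transpose_mat V * (V * transpose_mat U))"
      by (rule assoc_mult_mat[OF U(1) VT VUT])
    also have "transpose_mat V * (V * transpose_mat U) = transpose_mat U"
      using assoc_mult_mat[OF VT V(1) UT] UT unfolding V(2) by simp
    finally show ?thesis .
  qed
  have "is_moore_penrose X B"
    unfolding is_moore_penrose_def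
  proof (intro conjI)
    show "B \<in> carrier_mat (dim_col X) (dim_row X)" using X B by simp
    show "X * B * X = X" using assoc_mult_mat[OF X B X] BX X by simp
    show "B * X * B = B" unfolding BX using B by simp
    show "transpose_mat (X * B) = X * B" unfolding XB transpose_mult[OF U(1) UT] by simp
    show "transpose_mat (B * X) = B * X" unfolding BX by simp
  qed
  then have "moore_penrose X = B" by (rule moore_penrose_eqI)
  then have MBY: "layer_prod d W 1 L = B * Y" using ols by simp
  have M: "layer_prod d W 1 L = (1 / s) \<cdot>\<^sub>m (V * Z)"
    unfolding MBY B_def mult_smult_assoc_mat[OF VUT Y] Z_def
    using assoc_mult_mat[OF V(1) UT Y] by simp

  let ?E = "nonzero_eigenvalues (transpose_mat (W 1) * W 1)"
  let ?F = "nonzero_eigenvalues (transpose_mat Z * Z)"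
  have W1: "W 1 \<in> carrier_mat (d 1) ?r" using W[of 1] L by simp
  have spectra: "image_mset (\<lambda>x. x ^ L) ?E = image_mset (\<lambda>x. (1 / s)\<^sup>2 * x) ?F"
  proof -
    let ?S = "Z * transpose_mat Z"
    have VZ: "V * Z \<in> carrier_mat ?r (d L)" by (rule mult_carrier_mat[OF V(1) Z])
    have VZT: "transpose_mat (V * Z) \<in> carrier_mat (d L) ?r" using VZ by simp
    have S: "?S \<in> carrier_mat ?r ?r" by (rule mult_carrier_mat[OF Z ZT])
    have VS: "V * ?S * transpose_mat V = V * Z * transpose_mat (V * Z)"
    proof -
      have "V * Z * transpose_mat (V * Z) = V * Z * (transpose_mat Z * transpose_mat V)"
        unfolding transpose_mult[OF V(1) Z] ..
      also have "\<dots> = V * Z * transpose_mat Z * transpose_mat V"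
        by (rule assoc_mult_mat[OF VZ ZT VT, symmetric])
      also have "V * Z * transpose_mat Z = V * ?S" by (rule assoc_mult_mat[OF V(1) Z ZT])
      finally show ?thesis ..
    qed
    have symVS: "transpose_mat (V * ?S * transpose_mat V) = V * ?S * transpose_mat V"
      unfolding VS transpose_mult[OF VZ VZT] by simp
    have VSc: "V * ?S * transpose_mat V \<in> carrier_mat ?r ?r"
      by (rule mult_carrier_mat[OF mult_carrier_mat[OF V(1) S] VT])
    have G: "transpose_mat (W 1) * W 1 \<in> carrier_mat ?r ?r" using W1 by auto
    have symG: "transpose_mat (transpose_mat (W 1) * W 1) = transpose_mat (W 1) * W 1"
      using W1 by (subst transpose_mult[of _ ?r "d 1" _ ?r]) auto
    have tr: "transpose_mat ((1 / s) \<cdot>\<^sub>m (V * Z)) = (1 / s) \<cdot>\<^sub>m transpose_mat (V * Z)"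
      by (rule eq_matI) auto
    have "(transpose_mat (W 1) * W 1) ^\<^sub>m L = layer_prod d W 1 L * transpose_mat (layer_prod d W 1 L)"
      using layer_prod_gram[of L] by simp
    also have "\<dots> = (1 / s)\<^sup>2 \<cdot>\<^sub>m (V * ?S * transpose_mat V)"
      unfolding M tr VS mult_smult_assoc_mat[OF VZ smult_carrier_mat[OF VZT]]
        mult_smult_distrib[OF VZ VZT] by (rule eq_matI) (auto simp: power2_eq_square)
    finally have "nonzero_eigenvalues ((transpose_mat (W 1) * W 1) ^\<^sub>m L)
        = nonzero_eigenvalues ((1 / s)\<^sup>2 \<cdot>\<^sub>m (V * ?S * transpose_mat V))" by simp
    also have "\<dots> = image_mset (\<lambda>x. (1 / s)\<^sup>2 * x) (nonzero_eigenvalues (V * ?S * transpose_mat V))"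
      by (rule nonzero_eigenvalues_smult[OF VSc symVS]) (use s in simp)
    \<comment> \<open>Conjugation by \<open>V\<close> keeps the spectrum, and the factors are
      swapped because the singular values of \<open>Z\<close> are defined by
      \<open>Z\<^sup>T Z\<close>.\<close>
    also have "nonzero_eigenvalues (V * ?S * transpose_mat V) = ?F"
      unfolding nonzero_eigenvalues_orthogonal_conj[OF V S] by (rule nonzero_eigenvalues_mult_swap[OF Z ZT])
    finally show ?thesis using nonzero_eigenvalues_pow[OF G symG, of L] L by simp
  qed
  have E0: "x \<ge> 0" if "x \<in># ?E" for x by (rule nonzero_eigenvalues_gram_nonneg[OF W1 that])
  have F0: "x \<ge> 0" if "x \<in># ?F" for x by (rule nonzero_eigenvalues_gram_nonneg[OF Z that])
  \<comment> \<open>Taking \<open>L\<close>-th powers and scaling by a positive constant are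
    monotone on nonnegative numbers and fix 0. So the equality of multisets passes to each ordered
    position, including those filled with 0.\<close>
  have nth: "(nth_largest ?E i) ^ L = (1 / s)\<^sup>2 * nth_largest ?F i" for i
  proof -
    have "(nth_largest ?E i) ^ L = nth_largest (image_mset (\<lambda>x. x ^ L) ?E) i"
      by (rule nth_largest_image_mset[OF E0, symmetric]) (use L in \<open>auto simp: mono_on_def power_mono\<close>)
    also have "\<dots> = (1 / s)\<^sup>2 * nth_largest ?F i"
      unfolding spectra
      by (rule nth_largest_image_mset[OF F0]) (auto simp: mono_on_def intro!: mult_left_mono divide_right_mono)
    finally show ?thesis .
  qed
  have sv: "singular_value (W l) i =
      s powr (- 1 / real L) * singular_value Z i powr (1 / real L)"
    if l: "l \<in> {1..L}" and i: "i \<in> {1..Min (d ` {0..L})}" for l i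
  proof -
    \<comment> \<open>An index up to the smallest width is valid in every layer and in
      \<open>Z\<close>, whose shape is \<open>d 0\<close> by \<open>d L\<close>.\<close>
    have i_le: "i \<le> d k" if "k \<le> L" for k
    proof -
      have "Min (d ` {0..L}) \<le> d k" by (rule Min_le) (use that in auto)
      moreover have "i \<le> Min (d ` {0..L})" using i by (simp only: atLeastAtMost_iff)
      ultimately show ?thesis by (rule order_trans[rotated])
    qed
    have l1: "l - 1 \<le> L" using l by auto
    have "nonzero_eigenvalues (transpose_mat (W l) * W l) = ?E"
      using nonzero_eigenvalues_layer[of "l - 1"] l by simp
    then have "singular_value (W l) i = sqrt (nth_largest ?E (i - 1))"
      using singular_value_eq_nth_largest[OF W[OF l], of i] i i_le[of l] i_le[OF l1] l by simp
    also have "\<dots> = s powr (- 1 / real L) * sqrt (nth_largest ?F (i - 1)) powr (1 / real L)"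
      by (rule sqrt_eq_scaled_root[OF nth_largest_nonneg[OF E0] nth_largest_nonneg[OF F0] s L nth])
    also have "sqrt (nth_largest ?F (i - 1)) = singular_value Z i"
      using singular_value_eq_nth_largest[OF Z, of i] i i_le[of 0] i_le[of L] by simp
    finally show ?thesis .
  qed

  define \<tau> where "\<tau> = spectral_norm Z"
  have \<tau>: "\<tau> = singular_value Z 1" unfolding \<tau>_def by (rule spectral_norm_eq_singular_value[OF Z dd])
  have \<tau>0: "\<tau> \<ge> 0" unfolding \<tau>_def by (rule spectral_norm_nonneg[OF Z dd])
  \<comment> \<open>The singular value formula at index 1, which is admissible because all widths
    are positive; it is the common spectral norm of the layers.\<close>
  define \<sigma> where "\<sigma> = s powr (- 1 / real L) * \<tau> powr (1 / real L)"
  have \<sigma>0: "\<sigma> \<ge> 0" unfolding \<sigma>_def by simp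
  have "Min (d ` {0..L}) \<in> d ` {0..L}" by (rule Min_in) auto
  then have Min1: "Min (d ` {0..L}) \<ge> 1" using d by auto
  have \<sigma>W: "spectral_norm (W (Suc l)) = \<sigma>" if l: "Suc l \<le> L" for l
    using spectral_norm_eq_singular_value[OF W_Suc[OF l]] sv[of "Suc l" 1] d[of l] d[of "Suc l"] l Min1
    unfolding \<sigma>_def \<tau> by simp
  have \<tau>\<sigma>: "\<tau> = s * \<sigma> ^ L"
    unfolding \<sigma>_def power_mult_distrib powr_root_power[OF \<tau>0 L] powr_neg_root_power[OF s L]
    using s by simp

  have UVo: "transpose_mat (U * transpose_mat V) * (U * transpose_mat V) = 1\<^sub>m ?r"
    unfolding transpose_mult[OF U(1) VT] using VU_UV by simp
  have Xv: "X *\<^sub>v v = s \<cdot>\<^sub>v (U * transpose_mat V *\<^sub>v v)" if "v \<in> carrier_vec ?r" for v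
    unfolding Xs by (rule eq_vecI) (use UVT that in auto)
  have X_norm: "vec_norm2 (X *\<^sub>v v) = s * vec_norm2 v" if v: "v \<in> carrier_vec ?r" for v
    unfolding Xv[OF v] vec_norm2_smult vec_norm2_isometry[OF UVT UVo v] using s by simp
  have sX: "spectral_norm X = s"
  proof (rule spectral_norm_eqI[OF X])
    have "vec_norm2 (unit_vec ?r 0) = 1" using dd by (simp add: vec_norm2_def)
    then show "vec_norm2 (unit_vec ?r 0) = 1" "vec_norm2 (X *\<^sub>v unit_vec ?r 0) = s"
      using X_norm[of "unit_vec ?r 0"] by auto
  qed (use X_norm in auto)
  have XT: "transpose_mat X \<in> carrier_mat ?r n" using X by simp
  have XT_le: "vec_norm2 (transpose_mat X *\<^sub>v w) \<le> s * vec_norm2 w" if w: "w \<in> carrier_vec n" for w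
    using spectral_norm_bound[OF XT dd(1) n w] spectral_norm_transpose[OF X n dd(1)] sX by simp
  \<comment> \<open>\<open>X\<close> is \<open>s\<close> times the isometry
    \<open>U V\<^sup>T\<close>, so the image of \<open>p\<close> under this isometry is the partner
    of \<open>p\<close>.\<close>
  have X_pair: "\<exists>w \<in> carrier_vec n. vec_norm2 w = vec_norm2 p
        \<and> X *\<^sub>v p = s \<cdot>\<^sub>v w \<and> transpose_mat X *\<^sub>v w = s \<cdot>\<^sub>v p" if p: "p \<in> carrier_vec ?r" for p
  proof (intro bexI conjI)
    let ?w = "U * transpose_mat V *\<^sub>v p"
    show w: "?w \<in> carrier_vec n" by (rule mult_mat_vec_carrier[OF UVT p])
    show "vec_norm2 ?w = vec_norm2 p" by (rule vec_norm2_isometry[OF UVT UVo p])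
    show "X *\<^sub>v p = s \<cdot>\<^sub>v ?w" by (rule Xv[OF p])
    have UVTT: "transpose_mat (U * transpose_mat V) \<in> carrier_mat ?r n" using UVT by simp
    have "transpose_mat X *\<^sub>v ?w = s \<cdot>\<^sub>v (transpose_mat (U * transpose_mat V) *\<^sub>v ?w)"
      unfolding Xs by (rule eq_vecI) (use UVT w in auto)
    also have "transpose_mat (U * transpose_mat V) *\<^sub>v ?w = p"
      using assoc_mult_mat_vec[OF UVTT UVT p] p unfolding UVo by simp
    finally show "transpose_mat X *\<^sub>v ?w = s \<cdot>\<^sub>v p" .
  qed
  have s0: "s \<ge> 0" using s by simp
  have ntk: "spectral_norm (ntk d L W X) = real L * s\<^sup>2 * \<sigma> ^ (2 * (L - 1)) / real n"
    "lambda_max (ntk d L W X) = real L * s\<^sup>2 * \<sigma> ^ (2 * (L - 1)) / real n"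
    by (rule ntk_lambda_max[OF n X s0]; use X_norm XT_le X_pair \<sigma>W in simp)+
  have lam: "lambda_max (ntk d L W X) = real L * rpow ((spectral_norm X)\<^sup>2 / real n) (1 / real L)
      * rpow ((spectral_norm Z)\<^sup>2 / real n) (1 - 1 / real L)"
    unfolding ntk(2) sX \<tau>_def[symmetric] by (rule ntk_value_eq_rpow[OF s \<sigma>0 L n \<tau>\<sigma>])

  have sU: "spectral_norm U = 1"
  proof (rule spectral_norm_eqI[OF U(1)])
    have "vec_norm2 (unit_vec ?r 0) = 1" using dd by (simp add: vec_norm2_def)
    then show "vec_norm2 (unit_vec ?r 0) = 1" "vec_norm2 (U *\<^sub>v unit_vec ?r 0) = 1"
      using vec_norm2_isometry[OF U, of "unit_vec ?r 0"] by auto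
  qed (use vec_norm2_isometry[OF U] in auto)
  \<comment> \<open>\<open>U\<^sup>T\<close> does not increase lengths, since its spectral norm is
    that of the isometry \<open>U\<close>.\<close>
  have ZY: "spectral_norm Z \<le> spectral_norm Y"
  proof (rule spectral_norm_le[OF Z dd(2)])
    fix v :: "real vec" assume v: "v \<in> carrier_vec (d L)"
    have Yv: "Y *\<^sub>v v \<in> carrier_vec n" by (rule mult_mat_vec_carrier[OF Y v])
    have "vec_norm2 (Z *\<^sub>v v) = vec_norm2 (transpose_mat U *\<^sub>v (Y *\<^sub>v v))"
      unfolding Z_def assoc_mult_mat_vec[OF UT Y v] ..
    also have "\<dots> \<le> vec_norm2 (Y *\<^sub>v v)"
      using spectral_norm_bound[OF UT dd(1) n Yv] spectral_norm_transpose[OF U(1) n dd(1)] sU by simp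
    also have "\<dots> \<le> spectral_norm Y * vec_norm2 v" by (rule spectral_norm_bound[OF Y n dd(2) v])
    finally show "vec_norm2 (Z *\<^sub>v v) \<le> spectral_norm Y * vec_norm2 v" .
  qed
  have le: "lambda_max (ntk d L W X) \<le> real L * rpow ((spectral_norm X)\<^sup>2 / real n) (1 / real L)
      * rpow ((spectral_norm Y)\<^sup>2 / real n) (1 - 1 / real L)"
    unfolding lam using L \<tau>0 ZY
    by (intro mult_left_mono rpow_mono mult_nonneg_nonneg rpow_nonneg divide_right_mono power_mono)
      (auto simp: \<tau>_def)
  \<comment> \<open>Zero loss means \<open>Y = X B Y = U U\<^sup>T Y = U Z\<close>. As
    \<open>U\<close> is an isometry, \<open>Y\<close> and \<open>Z\<close> then stretch every vector
    equally.\<close>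
  have loss0: "spectral_norm Y = spectral_norm Z" if "loss d L W X Y = 0"
  proof (rule antisym[OF _ ZY])
    have BY: "B * Y \<in> carrier_mat ?r (d L)" by (rule mult_carrier_mat[OF B Y])
    have XBY: "X * (B * Y) \<in> carrier_mat n (d L)" by (rule mult_carrier_mat[OF X BY])
    have "frobenius_norm (X * layer_prod d W 1 L - Y) = 0"
      using that n X by (simp add: loss_def)
    then have "X * (B * Y) = Y" unfolding MBY by (rule frobenius_norm_diff_eq_0[OF XBY Y])
    then have "Y = U * transpose_mat U * Y" using assoc_mult_mat[OF X B Y] XB by simp
    then have YU: "Y = U * Z" unfolding Z_def using assoc_mult_mat[OF U(1) UT Y] by simp
    show "spectral_norm Y \<le> spectral_norm Z"
    proof (rule spectral_norm_le[OF Y dd(2)])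
      fix v :: "real vec" assume v: "v \<in> carrier_vec (d L)"
      have "vec_norm2 (Y *\<^sub>v v) = vec_norm2 (U *\<^sub>v (Z *\<^sub>v v))"
        using YU assoc_mult_mat_vec[OF U(1) Z v] by simp
      also have "\<dots> = vec_norm2 (Z *\<^sub>v v)" by (rule vec_norm2_isometry[OF U mult_mat_vec_carrier[OF Z v]])
      also have "\<dots> \<le> spectral_norm Z * vec_norm2 v" by (rule spectral_norm_bound[OF Z dd v])
      finally show "vec_norm2 (Y *\<^sub>v v) \<le> spectral_norm Z * vec_norm2 v" .
    qed
  qed
  show ?thesis
    unfolding Z_def[symmetric]
    using sv ntk lam le loss0 by auto
qed

end
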